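(* There exist functions $f, g \in L^1(\mathbb{R})$ for which the bilinear Hardy--Littlewood maximal function $$M^*(f,g)(x) = \sup_{t>0}\frac{1}{2t}\int_{-t}^{t} f(x+s)\,g(x+2s)\,ds$$ is not almost everywhere finite (with respect to Lebesgue measure on $\mathbb{R}$).
   Context: $L^1(\mathbb{R})$ is taken with respect to Lebesgue measure. "Not almost everywhere finite" means that it is false that $M^*(f,g)(x)<\infty$ for Lebesgue-almost every $x\in\mathbb{R}$. *)

theory Defs
  imports "HOL-Analysis.Analysis"
begin

text \<open>
  The supremum of the averages is taken in the extended reals, so it may be infinite.
  For integrable f and g, Tonelli's theorem and the area-preserving substitution
  (x, s) to (x + s, x + 2 s) show that f (x + s) * g (x + 2 s) is integrable in s over the
  whole line for almost every x. The convention that the integral of a non-integrable function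
  is 0 therefore affects the function below only on a null set of points x.
\<close>

definition bilinear_maximal :: "(real \<Rightarrow> real) \<Rightarrow> (real \<Rightarrow> real) \<Rightarrow> real \<Rightarrow> ereal" where
  "bilinear_maximal f g x =
     (SUP t\<in>{0<..}. ereal (1 / (2 * t) * (LINT s:{-t..t}|lebesgue. f (x + s) * g (x + 2 * s))))"

end

theory Submission
  imports Defs
begin

text \<open>
  The maximal function only sees pairs of points \<^term>\<open>p = x + s\<close>, \<^term>\<open>q = x + 2 * s\<close>, so that
  \<^term>\<open>x = 2 * p - q\<close>. If \<^term>\<open>f\<close> and \<^term>\<open>g\<close> are sums of bumps on cells of unit length, a bump of height
  \<open>a\<close> at \<open>p\<close> and a bump of height \<open>b\<close> at \<open>q\<close> make the average at \<open>x\<close> of order \<open>a b / s\<close>. Suppose that each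
  cell \<open>i\<close> carries a bump of height \<open>A i\<close> of \<open>f\<close> with probability \<open>\<epsilon> / A i\<close> and a bump of height \<open>B i\<close> of \<open>g\<close>
  with probability \<open>\<epsilon> / B i\<close>, independently. Then both functions have mean about \<open>\<epsilon>\<close>, whatever the heights are.
  For a fixed \<open>x\<close> different values of \<open>s\<close> involve different cells, so the events that \<open>s\<close> yields an average of
  order one at \<open>x\<close> are independent, and \<open>x\<close> is missed with probability at most \<open>exp (- \<epsilon>\<^sup>2 \<Phi> x)\<close>, where
  \<open>\<Phi> x\<close> is the sum of \<open>1 / (A (x + s) * B (x + 2 * s))\<close> over those \<open>s\<close> that are at most
  \<open>A (x + s) * B (x + 2 * s)\<close>. Constant heights only give \<open>\<Phi> \<le> 1\<close>. The claim follows once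
  heights are found for which \<open>\<Phi>\<close> is as large as desired at most points: the norms can then be made arbitrarily
  small while the averages stay of order one on a fixed portion of an interval.

  Such heights are built level by level (\<open>height_profile_step\<close>). Given \<open>A\<close> and \<open>B\<close>, cut the line into very
  long cells of length \<open>T\<close>, multiply \<open>A\<close> by a huge \<open>R\<close> on every other cell and divide \<open>B\<close> by \<open>R\<close> on the same
  cells. For short \<open>s\<close> all of \<open>x\<close>, \<open>x + s\<close>, \<open>x + 2 * s\<close> lie in one cell, the two changes cancel, and the
  old contribution to \<open>\<Phi>\<close> survives. Among the \<open>s\<close> of order \<open>R\<close> a fixed proportion puts \<open>x + s\<close> in a
  cell where \<open>A\<close> was raised and \<open>x + 2 * s\<close> in a cell where \<open>B\<close> was kept. By periodicity these \<open>s\<close> add a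
  fixed amount to \<open>\<Phi>\<close>, since each residue class of \<open>s\<close> on which the product of the heights is \<open>u\<close> has about
  \<open>R u / (2 T)\<close> members below \<open>R u\<close>, each of weight \<open>1 / (R u)\<close> (\<open>crossing_gain\<close>). The total mass of \<open>f\<close> and
  \<open>g\<close> is unaffected, and yet every level gains the same amount: this is why the endpoint estimate fails.

  Finally, the functions obtained for a sequence of levels are multiplied by growing constants and summed. The
  sums are integrable, for almost every \<open>x\<close> the product \<open>f (x + s) * g (x + 2 * s)\<close> is integrable in \<open>s\<close>, so
  the integral in the maximal function is the true one, and a set of points of positive measure lies in infinitely many
  of the sets on which the averages of the summands are large.
\<close>

section \<open>Random subsets of a finite set\<close>

text \<open>
  The expectation of \<open>h F\<close> when \<open>F\<close> is a random subset of \<open>I\<close> containing each \<open>i\<close> independently with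
  probability \<open>\<phi> i\<close>. Writing it as a finite sum over all subsets makes linearity and the product formula
  purely algebraic.
\<close>

definition subset_mean :: "'a set \<Rightarrow> ('a \<Rightarrow> real) \<Rightarrow> ('a set \<Rightarrow> real) \<Rightarrow> real" where
  "subset_mean I \<phi> h = (\<Sum>F\<in>Pow I. (\<Prod>i\<in>F. \<phi> i) * (\<Prod>i\<in>I - F. 1 - \<phi> i) * h F)"

lemma subset_mean_add: "subset_mean I \<phi> (\<lambda>F. h F + k F) = subset_mean I \<phi> h + subset_mean I \<phi> k"
  by (simp add: subset_mean_def sum.distrib distrib_left)

lemma subset_mean_sum: "subset_mean I \<phi> (\<lambda>F. \<Sum>j\<in>J. h j F) = (\<Sum>j\<in>J. subset_mean I \<phi> (h j))"
  unfolding subset_mean_def sum_distrib_left by (rule sum.swap)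

lemma subset_mean_cmult: "subset_mean I \<phi> (\<lambda>F. c * h F) = c * subset_mean I \<phi> h"
  by (simp add: subset_mean_def sum_distrib_left mult_ac)

text \<open>
  Independence: expanding the product on the right over the choices "in" and "out" for each element gives the sum
  over all subsets.
\<close>

lemma subset_mean_prod:
  assumes "finite I"
  shows "subset_mean I \<phi> (\<lambda>F. \<Prod>i\<in>F. c i) = (\<Prod>i\<in>I. 1 - \<phi> i * (1 - c i))"
proof -
  have "(\<Prod>i\<in>I. 1 - \<phi> i * (1 - c i)) = (\<Prod>i\<in>I. \<phi> i * c i + (1 - \<phi> i))"
    by (intro prod.cong) (auto simp: algebra_simps)
  also have "\<dots> = (\<Sum>F\<in>Pow I. (\<Prod>i\<in>F. \<phi> i * c i) * (\<Prod>i\<in>I - F. 1 - \<phi> i))"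
    using assms by (rule prod_add)
  finally show ?thesis
    by (simp add: subset_mean_def prod.distrib mult_ac)
qed

lemma subset_mean_const:
  assumes "finite I"
  shows "subset_mean I \<phi> (\<lambda>F. c) = c"
proof -
  have "subset_mean I \<phi> (\<lambda>F. \<Prod>i\<in>F. 1) = 1"
    by (subst subset_mean_prod[OF assms]) simp
  then have "subset_mean I \<phi> (\<lambda>F. 1) = 1" by simp
  then show ?thesis using subset_mean_cmult[of I \<phi> c "\<lambda>F. 1"] by simp
qed

lemma subset_mean_mono:
  assumes "\<And>i. i \<in> I \<Longrightarrow> 0 \<le> \<phi> i \<and> \<phi> i \<le> 1"
    and "\<And>F. F \<subseteq> I \<Longrightarrow> h F \<le> k F"
  shows "subset_mean I \<phi> h \<le> subset_mean I \<phi> k"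
  unfolding subset_mean_def
  by (intro sum_mono mult_left_mono mult_nonneg_nonneg prod_nonneg) (use assms in auto)

text \<open>
  The event \<open>j \<notin> F\<close> is the product over \<open>F\<close> of the indicators of \<open>i \<noteq> j\<close>, so the product formula gives
  its probability.
\<close>

lemma subset_mean_mem:
  assumes "finite I" "j \<in> I"
  shows "subset_mean I \<phi> (\<lambda>F. of_bool (j \<in> F)) = \<phi> j"
proof -
  have "subset_mean I \<phi> (\<lambda>F. \<Prod>i\<in>F. of_bool (i \<noteq> j)) = (\<Prod>i\<in>I. 1 - \<phi> i * (1 - of_bool (i \<noteq> j)))"
    by (rule subset_mean_prod[OF assms(1)])
  also have "\<dots> = (\<Prod>i\<in>I. if i = j then 1 - \<phi> j else 1)"
    by (intro prod.cong) auto
  also have "\<dots> = 1 - \<phi> j" using assms by simp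
  finally have *: "subset_mean I \<phi> (\<lambda>F. \<Prod>i\<in>F. of_bool (i \<noteq> j)) = 1 - \<phi> j" .
  have "subset_mean I \<phi> (\<lambda>F. 1) =
      subset_mean I \<phi> (\<lambda>F. of_bool (j \<in> F) + (\<Prod>i\<in>F. of_bool (i \<noteq> j)))"
    unfolding subset_mean_def
  proof (intro sum.cong refl)
    fix F assume "F \<in> Pow I"
    then have "finite F" using assms finite_subset by auto
    then have "(\<Prod>i\<in>F. of_bool (i \<noteq> j)) = (of_bool (j \<notin> F) :: real)"
      by (induction F) auto
    then show "(\<Prod>i\<in>F. \<phi> i) * (\<Prod>i\<in>I - F. 1 - \<phi> i) * 1 =
       (\<Prod>i\<in>F. \<phi> i) * (\<Prod>i\<in>I - F. 1 - \<phi> i) * (of_bool (j \<in> F) + (\<Prod>i\<in>F. of_bool (i \<noteq> j)))"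
      by auto
  qed
  then show ?thesis
    unfolding subset_mean_add subset_mean_const[OF assms(1)] * by simp
qed

lemma subset_mean_weight:
  assumes "finite I"
  shows "subset_mean I \<phi> (\<lambda>F. \<Sum>i\<in>F. a i) = (\<Sum>i\<in>I. a i * \<phi> i)"
proof -
  have "subset_mean I \<phi> (\<lambda>F. \<Sum>i\<in>F. a i) = subset_mean I \<phi> (\<lambda>F. \<Sum>i\<in>I. a i * of_bool (i \<in> F))"
    unfolding subset_mean_def
  proof (intro sum.cong refl)
    fix F assume "F \<in> Pow I"
    then have "(\<Sum>i\<in>F. a i) = (\<Sum>i\<in>I. a i * of_bool (i \<in> F))"
      using assms by (intro sum.mono_neutral_cong_left) auto
    then show "(\<Prod>i\<in>F. \<phi> i) * (\<Prod>i\<in>I - F. 1 - \<phi> i) * (\<Sum>i\<in>F. a i) =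
       (\<Prod>i\<in>F. \<phi> i) * (\<Prod>i\<in>I - F. 1 - \<phi> i) * (\<Sum>i\<in>I. a i * of_bool (i \<in> F))" by simp
  qed
  also have "\<dots> = (\<Sum>i\<in>I. a i * subset_mean I \<phi> (\<lambda>F. of_bool (i \<in> F)))"
    by (simp only: subset_mean_sum subset_mean_cmult)
  finally show ?thesis using assms by (simp add: subset_mean_mem)
qed

lemma subset_mean_attained:
  assumes "finite I" "\<And>i. i \<in> I \<Longrightarrow> 0 \<le> \<phi> i \<and> \<phi> i \<le> 1"
  obtains F where "F \<subseteq> I" "h F \<le> subset_mean I \<phi> h"
proof -
  define m where "m = Min (h ` Pow I)"
  have "m \<in> h ` Pow I" unfolding m_def using assms(1) by (intro Min_in) auto
  then obtain F where F: "F \<subseteq> I" "h F = m" by auto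
  have "m \<le> h F'" if "F' \<subseteq> I" for F' unfolding m_def using assms(1) that by (intro Min_le) auto
  then have "subset_mean I \<phi> (\<lambda>F. m) \<le> subset_mean I \<phi> h"
    by (intro subset_mean_mono assms(2))
  with F show ?thesis by (intro that[of F]) (auto simp: subset_mean_const assms(1))
qed

text \<open>
  For fixed \<open>n\<close> the points \<open>n + s\<close> are distinct for distinct \<open>s\<close>, and so are the points \<open>n + 2 * s\<close>.
  Hence the events for different \<open>s\<close> are independent, although one element may be a point of both kinds: the two
  random sets are independent of each other. Formally the product formula is applied twice, first to \<open>G\<close> with \<open>F\<close>
  fixed, then to \<open>F\<close>.
\<close>

lemma mean_no_progression:
  fixes n :: nat and \<phi> \<gamma> :: "nat \<Rightarrow> real"
  assumes "finite I" "finite W"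
    and W: "\<And>s. s \<in> W \<Longrightarrow> n + s \<in> I \<and> n + 2 * s \<in> I"
  shows "subset_mean I \<phi> (\<lambda>F. subset_mean I \<gamma> (\<lambda>G.
           of_bool (\<forall>s\<in>W. \<not> (n + s \<in> F \<and> n + 2 * s \<in> G)))) =
         (\<Prod>s\<in>W. 1 - \<phi> (n + s) * \<gamma> (n + 2 * s))"
proof -
  have inner: "subset_mean I \<gamma> (\<lambda>G. of_bool (\<forall>s\<in>W. \<not> (n + s \<in> F \<and> n + 2 * s \<in> G))) =
      (\<Prod>i\<in>F. if i \<in> (\<lambda>s. n + s) ` W then 1 - \<gamma> (2 * i - n) else 1)" if "F \<subseteq> I" for F
  proof -
    have fF: "finite F" using that assms(1) finite_subset by auto
    define W' where "W' = {s\<in>W. n + s \<in> F}"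
    define c :: "nat \<Rightarrow> real" where "c k = of_bool (k \<notin> (\<lambda>s. n + 2 * s) ` W')" for k
    have "subset_mean I \<gamma> (\<lambda>G. of_bool (\<forall>s\<in>W. \<not> (n + s \<in> F \<and> n + 2 * s \<in> G))) =
       subset_mean I \<gamma> (\<lambda>G. \<Prod>k\<in>G. c k)"
      unfolding subset_mean_def
    proof (intro sum.cong refl arg_cong2[of _ _ _ _ "(*)"])
      fix G assume "G \<in> Pow I"
      then have "finite G" using assms(1) finite_subset by auto
      then show "of_bool (\<forall>s\<in>W. \<not> (n + s \<in> F \<and> n + 2 * s \<in> G)) = (\<Prod>k\<in>G. c k)"
        by (auto simp: c_def W'_def of_bool_def intro!: prod.neutral)
    qed
    also have "\<dots> = (\<Prod>k\<in>I. 1 - \<gamma> k * (1 - c k))"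
      by (rule subset_mean_prod[OF assms(1)])
    also have "\<dots> = (\<Prod>k\<in>(\<lambda>s. n + 2 * s) ` W'. 1 - \<gamma> k)"
      using assms(1) W by (intro prod.mono_neutral_cong_right) (auto simp: c_def W'_def)
    also have "\<dots> = (\<Prod>s\<in>W'. 1 - \<gamma> (n + 2 * s))"
      by (subst prod.reindex) (auto simp: inj_on_def)
    also have "\<dots> = (\<Prod>i\<in>(\<lambda>s. n + s) ` W'. 1 - \<gamma> (2 * i - n))"
      by (subst prod.reindex) (auto simp: inj_on_def algebra_simps)
    also have "\<dots> = (\<Prod>i\<in>F. if i \<in> (\<lambda>s. n + s) ` W then 1 - \<gamma> (2 * i - n) else 1)"
      using fF by (intro prod.mono_neutral_cong_left) (auto simp: W'_def)
    finally show ?thesis .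
  qed
  have "subset_mean I \<phi> (\<lambda>F. subset_mean I \<gamma> (\<lambda>G.
           of_bool (\<forall>s\<in>W. \<not> (n + s \<in> F \<and> n + 2 * s \<in> G)))) =
        subset_mean I \<phi> (\<lambda>F. \<Prod>i\<in>F. if i \<in> (\<lambda>s. n + s) ` W then 1 - \<gamma> (2 * i - n) else 1)"
    unfolding subset_mean_def[of I \<phi>] by (intro sum.cong refl arg_cong2[of _ _ _ _ "(*)"] inner) auto
  also have "\<dots> = (\<Prod>i\<in>I. 1 - \<phi> i * (1 - (if i \<in> (\<lambda>s. n + s) ` W then 1 - \<gamma> (2 * i - n) else 1)))"
    by (rule subset_mean_prod[OF assms(1)])
  also have "\<dots> = (\<Prod>i\<in>(\<lambda>s. n + s) ` W. 1 - \<phi> i * \<gamma> (2 * i - n))"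
    using assms(1) W by (intro prod.mono_neutral_cong_right) auto
  also have "\<dots> = (\<Prod>s\<in>W. 1 - \<phi> (n + s) * \<gamma> (n + 2 * s))"
    by (subst prod.reindex) (auto simp: inj_on_def algebra_simps)
  finally show ?thesis .
qed

text \<open>
  Keeping \<open>i\<close> with probability \<open>\<epsilon> / a i\<close> makes the expected mass \<open>\<epsilon>\<close> per element, independently of the
  heights, while each \<open>n\<close> is missed with probability at most \<open>exp (- \<Lambda>)\<close>. Bounding the expectation of the sum
  of the masses and of the number of missed points lets one choice of \<open>F\<close> and \<open>G\<close> control all three.
\<close>

lemma random_thinning:
  fixes a b :: "nat \<Rightarrow> real" and W :: "nat \<Rightarrow> nat set"
  assumes eps: "0 \<le> \<epsilon>" "\<epsilon> \<le> 1"
    and ab: "\<And>i. 1 \<le> a i" "\<And>i. 1 \<le> b i"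
    and X: "finite X"
    and W: "\<And>n. n \<in> X \<Longrightarrow> finite (W n)" "\<And>n s. n \<in> X \<Longrightarrow> s \<in> W n \<Longrightarrow> n + 2 * s < H"
    and \<Lambda>: "\<And>n. n \<in> X \<Longrightarrow> \<Lambda> \<le> (\<Sum>s\<in>W n. \<epsilon>\<^sup>2 / (a (n + s) * b (n + 2 * s)))"
  obtains F G where "F \<subseteq> {..<H}" "G \<subseteq> {..<H}"
    "(\<Sum>i\<in>F. a i) + (\<Sum>i\<in>G. b i) +
       card {n\<in>X. \<forall>s\<in>W n. \<not> (n + s \<in> F \<and> n + 2 * s \<in> G)} \<le> 2 * \<epsilon> * H + card X * exp (- \<Lambda>)"
proof -
  define \<phi> where "\<phi> i = \<epsilon> / a i" for i
  define \<gamma> where "\<gamma> i = \<epsilon> / b i" for i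
  let ?I = "{..<H}"
  have pos: "a i > 0" "b i > 0" for i using ab(1)[of i] ab(2)[of i] by auto
  have \<phi>: "0 \<le> \<phi> i \<and> \<phi> i \<le> 1" and \<gamma>: "0 \<le> \<gamma> i \<and> \<gamma> i \<le> 1" for i
    using eps ab(1)[of i] ab(2)[of i] pos[of i] by (auto simp: \<phi>_def \<gamma>_def divide_le_eq)
  define J :: "nat set \<Rightarrow> nat set \<Rightarrow> real" where
    "J F G = (\<Sum>i\<in>F. a i) + ((\<Sum>i\<in>G. b i) + (\<Sum>n\<in>X. of_bool (\<forall>s\<in>W n. \<not> (n + s \<in> F \<and> n + 2 * s \<in> G))))"
    for F G
  have unc: "(\<Prod>s\<in>W n. 1 - \<phi> (n + s) * \<gamma> (n + 2 * s)) \<le> exp (- \<Lambda>)" if "n \<in> X" for n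
  proof -
    have "(\<Prod>s\<in>W n. 1 - \<phi> (n + s) * \<gamma> (n + 2 * s)) \<le> (\<Prod>s\<in>W n. exp (- (\<phi> (n + s) * \<gamma> (n + 2 * s))))"
    proof (intro prod_mono conjI)
      fix s
      show "0 \<le> 1 - \<phi> (n + s) * \<gamma> (n + 2 * s)"
        using mult_mono[of "\<phi> (n + s)" 1 "\<gamma> (n + 2 * s)" 1] \<phi> \<gamma> by auto
      show "1 - \<phi> (n + s) * \<gamma> (n + 2 * s) \<le> exp (- (\<phi> (n + s) * \<gamma> (n + 2 * s)))"
        using exp_ge_add_one_self[of "- (\<phi> (n + s) * \<gamma> (n + 2 * s))"] by simp
    qed
    also have "\<dots> = exp (- (\<Sum>s\<in>W n. \<epsilon>\<^sup>2 / (a (n + s) * b (n + 2 * s))))"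
      using W(1)[OF that] by (simp add: exp_sum sum_negf[symmetric] \<phi>_def \<gamma>_def power2_eq_square)
    also have "\<dots> \<le> exp (- \<Lambda>)" using \<Lambda>[OF that] by simp
    finally show ?thesis .
  qed
  have "subset_mean ?I \<phi> (\<lambda>F. subset_mean ?I \<gamma> (J F)) =
      (\<Sum>i<H. a i * \<phi> i) + ((\<Sum>i<H. b i * \<gamma> i) +
      (\<Sum>n\<in>X. subset_mean ?I \<phi> (\<lambda>F. subset_mean ?I \<gamma> (\<lambda>G.
           of_bool (\<forall>s\<in>W n. \<not> (n + s \<in> F \<and> n + 2 * s \<in> G))))))"
    unfolding J_def by (simp only: subset_mean_add subset_mean_const subset_mean_weight subset_mean_sum finite_lessThan)
  also have "\<dots> = (\<Sum>i<H. a i * \<phi> i) + ((\<Sum>i<H. b i * \<gamma> i) +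
      (\<Sum>n\<in>X. \<Prod>s\<in>W n. 1 - \<phi> (n + s) * \<gamma> (n + 2 * s)))"
  proof (intro arg_cong2[of _ _ _ _ "(+)"] refl sum.cong mean_no_progression)
    fix n s assume ns: "n \<in> X" "s \<in> W n"
    show "n + s \<in> ?I \<and> n + 2 * s \<in> ?I" using W(2)[OF ns] by simp
  qed (use W(1) in auto)
  also have "\<dots> \<le> \<epsilon> * H + (\<epsilon> * H + card X * exp (- \<Lambda>))"
  proof (intro add_mono)
    show "(\<Sum>i<H. a i * \<phi> i) \<le> \<epsilon> * H" "(\<Sum>i<H. b i * \<gamma> i) \<le> \<epsilon> * H"
      using pos by (simp_all add: \<phi>_def \<gamma>_def less_imp_neq[THEN not_sym] mult.commute)
    show "(\<Sum>n\<in>X. \<Prod>s\<in>W n. 1 - \<phi> (n + s) * \<gamma> (n + 2 * s)) \<le> card X * exp (- \<Lambda>)"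
      using unc by (intro sum_bounded_above)
  qed
  finally have tot: "subset_mean ?I \<phi> (\<lambda>F. subset_mean ?I \<gamma> (J F)) \<le> 2 * \<epsilon> * H + card X * exp (- \<Lambda>)"
    by simp
  obtain F where F: "F \<subseteq> ?I" "subset_mean ?I \<gamma> (J F) \<le> subset_mean ?I \<phi> (\<lambda>F. subset_mean ?I \<gamma> (J F))"
    by (rule subset_mean_attained[of ?I \<phi> "\<lambda>F. subset_mean ?I \<gamma> (J F)"]) (use \<phi> in auto)
  obtain G where G: "G \<subseteq> ?I" "J F G \<le> subset_mean ?I \<gamma> (J F)"
    by (rule subset_mean_attained[of ?I \<gamma> "J F"]) (use \<gamma> in auto)
  have "J F G \<le> 2 * \<epsilon> * H + card X * exp (- \<Lambda>)" using F G tot by linarith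
  then have "(\<Sum>i\<in>F. a i) + (\<Sum>i\<in>G. b i) +
       card {n\<in>X. \<forall>s\<in>W n. \<not> (n + s \<in> F \<and> n + 2 * s \<in> G)} \<le> 2 * \<epsilon> * H + card X * exp (- \<Lambda>)"
    using X by (simp add: J_def of_bool_def sum.If_cases Int_def)
  then show ?thesis using F(1) G(1) that by blast
qed

section \<open>Height profiles with large pair density\<close>

text \<open>
  The function \<open>\<Phi>\<close> of the introduction, truncated at \<open>S\<close>: up to a factor \<open>\<epsilon>\<^sup>2\<close>, the expected number of pairs
  of bumps that give an average of order one at \<open>n\<close>.
\<close>

definition pair_density :: "(nat \<Rightarrow> real) \<Rightarrow> (nat \<Rightarrow> real) \<Rightarrow> nat \<Rightarrow> nat \<Rightarrow> real" where
  "pair_density A B S n =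
     (\<Sum>s\<in>{s\<in>{1..S}. real s \<le> A (n + s) * B (n + 2 * s)}. 1 / (A (n + s) * B (n + 2 * s)))"

text \<open>
  Heights with common period \<open>P\<close> whose pair density is at least \<open>c\<close> outside a set of density \<open>\<eta>\<close>. The
  exceptional set is counted on all multiples of the period, which is what the passage to a longer period uses.
\<close>

definition height_profile ::
    "real \<Rightarrow> real \<Rightarrow> nat \<Rightarrow> nat \<Rightarrow> real \<Rightarrow> (nat \<Rightarrow> real) \<Rightarrow> (nat \<Rightarrow> real) \<Rightarrow> bool" where
  "height_profile c \<eta> P S D A B \<longleftrightarrow>
     0 < P \<and> 1 \<le> D \<and>
     (\<forall>n. 1 / D \<le> A n \<and> A n \<le> D \<and> A (n + P) = A n) \<and>
     (\<forall>n. 1 / D \<le> B n \<and> B n \<le> D \<and> B (n + P) = B n) \<and>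
     (\<forall>k. real (card {n. n < k * P \<and> pair_density A B S n < c}) \<le> \<eta> * real (k * P))"

lemma periodic_shift:
  fixes A :: "nat \<Rightarrow> 'a"
  assumes "\<And>n. A (n + P) = A n"
  shows "A (n + P * k) = A n"
proof (induction k)
  case (Suc k)
  have "A (n + P * Suc k) = A ((n + P * k) + P)" by (simp add: algebra_simps)
  then show ?case using assms Suc by simp
qed simp

text \<open>
  Let \<open>p\<close> run through a cell of odd index. Then \<open>2 * p - n\<close> moves twice as fast and sweeps a whole period of the
  alternating cells, so it spends half of the time in cells of even index. It suffices to keep a quarter of the cell, a
  block that depends only on the residue of \<open>n\<close>; working with quarters is why \<open>T\<close> is a multiple of four.
\<close>

lemma crossing_block:
  fixes n T0 :: nat
  assumes "0 < T0" and T: "T = 4 * T0"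
  obtains j0 where "j0 + T0 \<le> T"
    "\<And>j m. j0 \<le> j \<Longrightarrow> j < j0 + T0 \<Longrightarrow> n < 2 * T * m \<Longrightarrow> even ((2 * (2 * T * m + T + j) - n) div T)"
proof -
  define n' where "n' = n div (2 * T)"
  define r where "r = 2 * T - n mod (2 * T)"
  have nT: "n mod (2 * T) < 2 * T" using assms by simp
  have r: "0 < r" "r \<le> 8 * T0" using nT T by (auto simp: r_def)
  have nr: "n + r = 2 * T * n' + 2 * T"
    using nT div_mult_mod_eq[of n "2 * T"] unfolding r_def n'_def by (simp add: algebra_simps)
  have "\<exists>j0. j0 + T0 \<le> T \<and> (\<forall>j. j0 \<le> j \<and> j < j0 + T0 \<longrightarrow> 2 * j + r < T \<or> 2 * T \<le> 2 * j + r \<and> 2 * j + r < 3 * T)"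
  proof -
    consider "r \<le> 2 * T0" | "2 * T0 < r" "r \<le> 4 * T0" | "4 * T0 < r" "r \<le> 6 * T0" | "6 * T0 < r"
      by linarith
    then show ?thesis
    proof cases
      case 1 show ?thesis by (rule exI[of _ 0]) (use 1 r T in auto)
    next
      case 2 show ?thesis by (rule exI[of _ "3 * T0"]) (use 2 r T in auto)
    next
      case 3 show ?thesis by (rule exI[of _ "2 * T0"]) (use 3 r T in auto)
    next
      case 4 show ?thesis by (rule exI[of _ "T0"]) (use 4 r T in auto)
    qed
  qed
  then obtain j0 where j0: "j0 + T0 \<le> T"
    and e: "\<And>j. j0 \<le> j \<Longrightarrow> j < j0 + T0 \<Longrightarrow> 2 * j + r < T \<or> 2 * T \<le> 2 * j + r \<and> 2 * j + r < 3 * T"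
    by blast
  show thesis
  proof (rule that[OF j0])
    fix j m assume j: "j0 \<le> j" "j < j0 + T0" and m: "n < 2 * T * m"
    have "n' < m" using m unfolding n'_def by (simp add: less_mult_imp_div_less mult.commute)
    then obtain d where d: "m = n' + d" using less_imp_add_positive by blast
    have eq: "2 * (2 * T * m + T + j) - n = (2 * j + r) + T * (2 * (n' + 2 * d))"
    proof -
      have "2 * (2 * T * m + T + j) + r = (2 * j + r) + T * (2 * (n' + 2 * d)) + (n + r)"
        unfolding nr d by (simp add: algebra_simps)
      then show ?thesis by linarith
    qed
    have "T > 0" using assms by simp
    then have "(2 * (2 * T * m + T + j) - n) div T = (2 * j + r) div T + 2 * (n' + 2 * d)"
      unfolding eq by simp
    moreover have "(2 * j + r) div T = 0 \<or> (2 * j + r) div T = 2"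
    proof -
      have "(2 * j + r) div T = 2" if "2 * T \<le> 2 * j + r" "2 * j + r < 3 * T"
        by (rule div_nat_eqI) (use that in \<open>auto simp: algebra_simps\<close>)
      then show ?thesis using e[OF j] by auto
    qed
    ultimately show "even ((2 * (2 * T * m + T + j) - n) div T)" by auto
  qed
qed

text \<open>
  This bounds the points that are so close to the right end of their cell that \<open>x + 2 * s\<close> with \<open>s \<le> S\<close> may leave it.
\<close>

lemma card_near_multiples:
  fixes S T K :: nat
  shows "card {n. n < K * T \<and> T \<le> n mod T + 2 * S} \<le> K * (2 * S)"
proof (cases "T = 0")
  case False
  let ?X = "{n. n < K * T \<and> T \<le> n mod T + 2 * S}"
  have "card ?X \<le> card ({..<K} \<times> {T - 2 * S..<T})"
  proof (rule card_inj_on_le)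
    show "inj_on (\<lambda>n. (n div T, n mod T)) ?X"
      by (rule inj_onI) (metis Pair_inject div_mult_mod_eq)
    show "(\<lambda>n. (n div T, n mod T)) ` ?X \<subseteq> {..<K} \<times> {T - 2 * S..<T}"
      using False by (auto simp: less_mult_imp_div_less)
  qed auto
  also have "\<dots> \<le> K * (2 * S)" by (auto simp: card_cartesian_product)
  finally show ?thesis .
qed simp

text \<open>
  The gain of one level. For \<open>j\<close> in the block of \<open>crossing_block\<close> and \<open>k \<ge> 0\<close> let \<open>s j k\<close> be the
  step that leads from \<open>n\<close> to the point at offset \<open>j\<close> of an odd cell, \<open>k\<close> periods further. By periodicity the
  product of the old heights is a number \<open>u j\<close> that does not depend on \<open>k\<close>. About \<open>R * u j / (2 * T)\<close>
  values of \<open>k\<close> satisfy \<open>s j k \<le> R * u j\<close>, and each contributes \<open>1 / (R * u j)\<close>, so that \<open>u j\<close> cancels and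
  each \<open>j\<close> contributes about \<open>1 / (2 * T)\<close>. The choice of \<open>R\<close> makes the rounding cost at most half of this,
  and there are \<open>T / 4\<close> values of \<open>j\<close>.
\<close>

lemma crossing_gain:
  fixes A B :: "nat \<Rightarrow> real" and n S S' T T0 P :: nat and R E :: real
  assumes "0 < T0" and T: "T = 4 * T0" and dvd: "P dvd T"
    and E: "1 \<le> E"
    and A: "\<And>n. 1 / E \<le> A n" "\<And>n. A n \<le> E" "\<And>n. A (n + P) = A n"
    and B: "\<And>n. 1 / E \<le> B n" "\<And>n. B n \<le> E" "\<And>n. B (n + P) = B n"
    and R: "R = 1 + 2 * (real (2 * T * (S + 2)) * E\<^sup>2)"
    and S': "R * E\<^sup>2 \<le> real S'"
  shows "1 / 16 \<le> (\<Sum>s\<in>{s\<in>{S + 1..S'}. odd ((n + s) div T) \<and> even ((n + 2 * s) div T) \<and>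
             real s \<le> R * (A (n + s) * B (n + 2 * s))}. 1 / (R * (A (n + s) * B (n + 2 * s))))"
    (is "_ \<le> sum ?g ?Z")
proof -
  have Tpos: "T > 0" using assms by simp
  have Epos: "E > 0" using E by simp
  define C where "C = 2 * T * (S + 2)"
  have R1: "R \<ge> 1" unfolding R by simp
  obtain j0 where j0: "j0 + T0 \<le> T"
    and j0_even: "\<And>j m. j0 \<le> j \<Longrightarrow> j < j0 + T0 \<Longrightarrow> n < 2 * T * m \<Longrightarrow>
        even ((2 * (2 * T * m + T + j) - n) div T)"
    using crossing_block[OF assms(1) T, of n] by blast
  \<comment> \<open>Starting \<open>S + 1\<close> periods after the one that contains \<open>n\<close> makes every step larger than \<open>S\<close>.\<close>
  define m0 where "m0 = n div (2 * T) + S + 1"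
  have m0: "n + 2 * T * S < 2 * T * m0" "2 * T * m0 \<le> n + 2 * T * (S + 1)"
  proof -
    have "n < 2 * T * (n div (2 * T) + 1)" "2 * T * (n div (2 * T)) \<le> n"
      using Tpos dividend_less_div_times[of "2 * T" n] times_div_less_eq_dividend[of "2 * T" n]
      by (simp_all add: algebra_simps)
    then show "n + 2 * T * S < 2 * T * m0" "2 * T * m0 \<le> n + 2 * T * (S + 1)"
      unfolding m0_def by (simp_all add: algebra_simps)
  qed
  define s where "s j k = 2 * T * m0 + T + j - n + 2 * T * k" for j k
  have ns: "n + s j k = 2 * T * (m0 + k) + T + j" for j k
    using m0 by (simp add: s_def algebra_simps)
  have n2s: "n + 2 * s j k = 2 * (2 * T * (m0 + k) + T + j) - n" for j k
    unfolding ns[symmetric] by simp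
  define u where "u j = A (n + s j 0) * B (n + 2 * s j 0)" for j
  obtain w where w: "T = P * w" using dvd by blast
  have u: "A (n + s j k) * B (n + 2 * s j k) = u j" for j k
  proof -
    have "n + s j k = n + s j 0 + P * (2 * w * k)" "n + 2 * s j k = n + 2 * s j 0 + P * (4 * w * k)"
      by (simp_all add: s_def w algebra_simps)
    then show ?thesis unfolding u_def using periodic_shift[of A P, OF A(3)] periodic_shift[of B P, OF B(3)] by metis
  qed
  have Apos: "A n > 0" and Bpos: "B n > 0" for n
    using A(1)[of n] B(1)[of n] Epos by (smt (verit) divide_pos_pos)+
  have u_bounds: "1 / E\<^sup>2 \<le> u j" "u j \<le> E\<^sup>2" for j
  proof -
    have "1 / E * (1 / E) \<le> u j" unfolding u_def using A(1) B(1) Epos Apos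
      by (intro mult_mono) (auto intro: less_imp_le)
    then show "1 / E\<^sup>2 \<le> u j" by (simp add: power2_eq_square)
    have "u j \<le> E * E" unfolding u_def using A(2) B(2) Epos Bpos
      by (intro mult_mono) (auto intro: less_imp_le)
    then show "u j \<le> E\<^sup>2" by (simp add: power2_eq_square)
  qed
  have upos: "u j > 0" for j using u_bounds(1)[of j] Epos by (smt (verit) divide_pos_pos zero_less_power)
  have RC: "2 * real C \<le> R * u j" for j
  proof -
    have "2 * real C = 2 * real C * E\<^sup>2 * (1 / E\<^sup>2)" using Epos by simp
    also have "\<dots> \<le> R * u j"
      by (intro mult_mono u_bounds) (use upos R1 in \<open>auto simp: R C_def algebra_simps intro: less_imp_le\<close>)
    finally show ?thesis .
  qed
  \<comment> \<open>The last \<open>k\<close> for which the crude bound \<open>s j k \<le> 2 * T * k + C\<close> guarantees \<open>s j k \<le> R * u j\<close>.\<close>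
  define k0 where "k0 j = nat \<lfloor>(R * u j - real C) / (2 * real T)\<rfloor>" for j
  let ?J = "{j0..<j0 + T0}"
  have k0_le: "2 * real T * real k + real C \<le> R * u j" if "k \<le> k0 j" for j k
  proof -
    have nn: "0 \<le> (R * u j - real C) / (2 * real T)" using RC[of j] Tpos by simp
    have "real k \<le> (R * u j - real C) / (2 * real T)"
      using that nn unfolding k0_def by (simp add: le_nat_floor nat_le_iff le_floor_iff le_nat_iff)
    then show ?thesis using Tpos by (simp add: field_simps)
  qed
  have k0_ge: "(R * u j - real C) / (2 * real T) \<le> real (Suc (k0 j))" for j
    unfolding k0_def by linarith
  have inj: "inj_on (\<lambda>(j, k). s j k) (Sigma ?J (\<lambda>j. {..k0 j}))"
  proof (rule inj_onI, clarsimp)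
    fix j k j' k' assume j: "j < j0 + T0" "j' < j0 + T0" and eq: "s j k = s j' k'"
    have *: "2 * T * (m0 + k) + (T + j) = 2 * T * (m0 + k') + (T + j')"
      using ns[of j k] ns[of j' k'] eq by simp
    have lt: "T + j < 2 * T" "T + j' < 2 * T" using j j0 by auto
    have "T + j = (2 * T * (m0 + k) + (T + j)) mod (2 * T)"
      using lt by (simp only: mod_mult_self4 mod_less)
    also have "\<dots> = T + j'" unfolding * using lt by (simp only: mod_mult_self4 mod_less)
    finally show "j = j' \<and> k = k'" using * Tpos by simp
  qed
  have sub: "(\<lambda>(j, k). s j k) ` Sigma ?J (\<lambda>j. {..k0 j}) \<subseteq> ?Z"
  proof (clarsimp, intro conjI)
    fix j k assume j: "j0 \<le> j" "j < j0 + T0" and k: "k \<le> k0 j"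
    have jT: "j < T" using j j0 by simp
    have sC: "s j k \<le> 2 * T * k + C"
      using m0(2) jT unfolding s_def C_def by (simp add: algebra_simps)
    have S_le: "S \<le> 2 * T * S" using Tpos by simp
    show "Suc S \<le> s j k" using m0(1) S_le Tpos unfolding s_def by linarith
    show le: "real (s j k) \<le> R * (A (n + s j k) * B (n + 2 * s j k))"
    proof -
      have "real (s j k) \<le> 2 * real T * real k + real C"
        using of_nat_mono[OF sC, where 'a = real] by simp
      also have "\<dots> \<le> R * u j" by (rule k0_le[OF k])
      finally show ?thesis unfolding u .
    qed
    have "R * u j \<le> R * E\<^sup>2" using u_bounds R1 by (intro mult_left_mono) auto
    then show "s j k \<le> S'" using le S' unfolding u by linarith
    show "odd ((n + s j k) div T)"
    proof -
      have "n + s j k = j + T * (2 * (m0 + k) + 1)" unfolding ns by (simp add: algebra_simps)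
      then have "(n + s j k) div T = (2 * (m0 + k) + 1) + j div T"
        using Tpos div_mult_self2[of T j "2 * (m0 + k) + 1"] by simp
      then show ?thesis using jT by simp
    qed
    have "n < 2 * T * (m0 + k)" using m0(1) by (simp add: algebra_simps)
    then show "even ((n + 2 * s j k) div T)" unfolding n2s by (intro j0_even j)
  qed
  have "1 / 16 = (\<Sum>j\<in>?J. 1 / (4 * real T))"
    using assms(1) by (simp add: T)
  also have "\<dots> \<le> (\<Sum>j\<in>?J. real (Suc (k0 j)) * (1 / (R * u j)))"
  proof (rule sum_mono)
    fix j
    have pos: "R * u j > 0" using R1 upos by simp
    have "1 / (4 * real T) \<le> (R * u j - real C) / (2 * real T) * (1 / (R * u j))"
      using RC[of j] pos Tpos by (simp add: divide_simps)
    also have "\<dots> \<le> real (Suc (k0 j)) * (1 / (R * u j))"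
      using k0_ge pos by (intro mult_right_mono) auto
    finally show "1 / (4 * real T) \<le> real (Suc (k0 j)) * (1 / (R * u j))" .
  qed
  also have "\<dots> = (\<Sum>j\<in>?J. \<Sum>k\<in>{..k0 j}. ?g (s j k))"
    by (simp add: u)
  also have "\<dots> = (\<Sum>(j, k)\<in>Sigma ?J (\<lambda>j. {..k0 j}). ?g (s j k))"
    by (simp add: sum.Sigma)
  also have "\<dots> = sum ?g ((\<lambda>(j, k). s j k) ` Sigma ?J (\<lambda>j. {..k0 j}))"
    by (subst sum.reindex[OF inj]) (simp add: case_prod_unfold)
  also have "\<dots> \<le> sum ?g ?Z"
    using R1 Apos Bpos by (intro sum_mono2 sub) (auto intro!: mult_nonneg_nonneg less_imp_le)
  finally show ?thesis .
qed

text \<open>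
  One more level of the construction. Steps \<open>s \<le> S\<close> stay inside a cell for all but a small proportion of the
  points, and there the factors \<open>R\<close> and \<open>1 / R\<close> cancel; the new contribution uses only steps \<open>s > S\<close>.
\<close>

lemma height_profile_step:
  assumes "height_profile c \<eta> P S D A B" and \<eta>': "0 < \<eta>'"
  obtains P' S' D' A' B' where "height_profile (c + 1 / 16) (\<eta> + \<eta>') P' S' D' A' B'"
proof -
  have P: "0 < P" and D: "1 \<le> D"
    and A: "\<And>n. 1 / D \<le> A n" "\<And>n. A n \<le> D" "\<And>n. A (n + P) = A n"
    and B: "\<And>n. 1 / D \<le> B n" "\<And>n. B n \<le> D" "\<And>n. B (n + P) = B n"
    and bad: "\<And>k. real (card {n. n < k * P \<and> pair_density A B S n < c}) \<le> \<eta> * real (k * P)"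
    using assms(1) unfolding height_profile_def by blast+
  have Dpos: "D > 0" using D by simp
  have Apos: "A n > 0" and Bpos: "B n > 0" for n
    using A(1)[of n] B(1)[of n] Dpos by (smt (verit) divide_pos_pos)+
  \<comment> \<open>The cells must be long compared with \<open>S\<close>, so that few points are near their ends.\<close>
  define q where "q = Suc (nat \<lceil>2 * real S / \<eta>'\<rceil>)"
  define T0 where "T0 = P * q"
  define T where "T = 4 * T0"
  have T0: "T0 > 0" using P by (simp add: T0_def q_def)
  then have Tpos: "T > 0" by (simp add: T_def)
  have PT: "P dvd T" by (simp add: T_def T0_def)
  have ST: "2 * real S \<le> \<eta>' * real T"
  proof -
    have "2 * real S / \<eta>' \<le> real q" unfolding q_def by linarith
    also have "q * 1 \<le> q * (4 * P)" using P by (intro mult_le_mono) auto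
    then have "real q \<le> real T" by (simp only: of_nat_le_iff T_def T0_def mult.assoc mult.commute mult.left_commute mult_1)
    finally show ?thesis using \<eta>' by (simp add: field_simps)
  qed
  define R where "R = 1 + 2 * (real (2 * T * (S + 2)) * D\<^sup>2)"
  have R1: "R \<ge> 1" unfolding R_def by simp
  define S' where "S' = max S (nat \<lceil>R * D\<^sup>2\<rceil>)"
  have S': "R * D\<^sup>2 \<le> real S'" "S \<le> S'" unfolding S'_def by linarith+
  define A' where "A' n = (if odd (n div T) then R * A n else A n)" for n
  define B' where "B' n = (if odd (n div T) then B n / R else B n)" for n
  have pos': "A' n * B' k > 0" for n k
    using R1 Apos Bpos by (auto simp: A'_def B'_def)
  have density: "c + 1 / 16 \<le> pair_density A' B' S' n"
    if old: "c \<le> pair_density A B S n" and inside: "n mod T + 2 * S < T" for n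
  proof -
    let ?g = "\<lambda>s. 1 / (A' (n + s) * B' (n + 2 * s))"
    let ?Y = "{s \<in> {1..S}. real s \<le> A (n + s) * B (n + 2 * s)}"
    let ?Z = "{s\<in>{S + 1..S'}. odd ((n + s) div T) \<and> even ((n + 2 * s) div T) \<and>
             real s \<le> R * (A (n + s) * B (n + 2 * s))}"
    have same: "(n + t) div T = n div T" if "t \<le> 2 * S" for t
    proof -
      have "n + t = (n mod T + t) + T * (n div T)" by simp
      then have "(n + t) div T = (n mod T + t) div T + n div T" using Tpos by (metis div_mult_self2 less_not_refl add.commute)
      then show ?thesis using that inside by simp
    qed
    have near: "A' (n + s) * B' (n + 2 * s) = A (n + s) * B (n + 2 * s)" if "s \<le> S" for s
      using that same[of s] same[of "2 * s"] R1 by (simp add: A'_def B'_def)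
    have far: "A' (n + s) * B' (n + 2 * s) = R * (A (n + s) * B (n + 2 * s))" if "s \<in> ?Z" for s
      using that by (simp add: A'_def B'_def)
    have "c + 1 / 16 \<le> sum ?g ?Y + sum ?g ?Z"
    proof (intro add_mono)
      have "sum ?g ?Y = pair_density A B S n"
        unfolding pair_density_def by (intro sum.cong refl) (simp add: near)
      then show "c \<le> sum ?g ?Y" using old by simp
      have "sum ?g ?Z = (\<Sum>s\<in>?Z. 1 / (R * (A (n + s) * B (n + 2 * s))))"
        by (intro sum.cong refl) (simp only: far)
      then show "1 / 16 \<le> sum ?g ?Z"
        using crossing_gain[where A = A and B = B and P = P and n = n, OF T0 T_def PT D A B R_def S'(1)] by simp
    qed
    also have "\<dots> = sum ?g (?Y \<union> ?Z)"
      by (intro sum.union_disjoint[symmetric]) auto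
    also have "\<dots> \<le> pair_density A' B' S' n"
      unfolding pair_density_def
    proof (intro sum_mono2)
      show "?Y \<union> ?Z \<subseteq> {s \<in> {1..S'}. real s \<le> A' (n + s) * B' (n + 2 * s)}"
        using near far S'(2) by auto
    qed (auto intro: less_imp_le pos')
    finally show ?thesis .
  qed
  have "height_profile (c + 1 / 16) (\<eta> + \<eta>') (2 * T) S' (R * D) A' B'"
    unfolding height_profile_def
  proof (intro conjI allI)
    show "0 < 2 * T" using Tpos by simp
    show "1 \<le> R * D" using R1 D mult_mono[of 1 R 1 D] by simp
    obtain w where w: "2 * T = P * w" using PT by (metis dvd_def dvd_mult)
    have div: "(n + 2 * T) div T = n div T + 2" for n using Tpos by simp
    fix n
    show "A' (n + 2 * T) = A' n" "B' (n + 2 * T) = B' n"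
      unfolding A'_def B'_def div unfolding w
      by (simp_all add: periodic_shift[of A P, OF A(3)] periodic_shift[of B P, OF B(3)])
    have RD: "1 / (R * D) \<le> 1 / D" "D \<le> R * D"
      using R1 Dpos by (auto simp: field_simps)
    have RA: "A n \<le> R * A n" using R1 Apos[of n] by simp
    show "1 / (R * D) \<le> A' n"
      unfolding A'_def using RD(1) A(1)[of n] RA by (auto simp only: split: if_splits)
    show "A' n \<le> R * D"
      unfolding A'_def using RD(2) A(2)[of n] R1 by auto
    have "1 / (R * D) \<le> B n / R" "B n / R \<le> D"
      using B(1)[of n] B(2)[of n] R1 Dpos Bpos[of n] mult_mono[of 1 R "B n" D]
      by (simp_all add: field_simps)
    then show "1 / (R * D) \<le> B' n" "B' n \<le> R * D"
      unfolding B'_def using RD B(1)[of n] B(2)[of n] by auto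
  next
    fix k
    let ?b = "{n. n < (k * (8 * q)) * P \<and> pair_density A B S n < c}"
    let ?e = "{n. n < (2 * k) * T \<and> T \<le> n mod T + 2 * S}"
    have kT: "k * (8 * q) * P = k * (2 * T)" by (simp add: T_def T0_def)
    have "{n. n < k * (2 * T) \<and> pair_density A' B' S' n < c + 1 / 16} \<subseteq> ?b \<union> ?e"
      using density by (force simp: kT not_less)
    then have "card {n. n < k * (2 * T) \<and> pair_density A' B' S' n < c + 1 / 16} \<le> card (?b \<union> ?e)"
      by (intro card_mono) auto
    also have "\<dots> \<le> card ?b + card ?e" by (rule card_Un_le)
    also have "\<dots> \<le> card ?b + 2 * k * (2 * S)"
      using card_near_multiples[of "2 * k" T S] by simp
    finally have "real (card {n. n < k * (2 * T) \<and> pair_density A' B' S' n < c + 1 / 16}) \<le>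
        real (card ?b + 2 * k * (2 * S))" by (simp only: of_nat_le_iff)
    also have "\<dots> = real (card ?b) + 2 * real k * (2 * real S)" by simp
    also have "\<dots> \<le> \<eta> * real (k * (2 * T)) + 2 * real k * (\<eta>' * real T)"
      using bad[of "k * (8 * q)"] ST unfolding kT by (intro add_mono mult_left_mono) auto
    also have "\<dots> = (\<eta> + \<eta>') * real (k * (2 * T))" by (simp add: algebra_simps)
    finally show "real (card {n. n < k * (2 * T) \<and> pair_density A' B' S' n < c + 1 / 16}) \<le>
        (\<eta> + \<eta>') * real (k * (2 * T))" .
  qed
  then show thesis by (rule that)
qed

lemma height_profile_exists:
  assumes "0 < \<eta>"
  shows "\<exists>P S D A B. height_profile (real L / 16) (real L * \<eta>) P S D A B"
proof (induction L)
  case 0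
  have "height_profile (real 0 / 16) (real 0 * \<eta>) 1 0 1 (\<lambda>_. 1) (\<lambda>_. 1)"
    by (simp add: height_profile_def pair_density_def)
  then show ?case by blast
next
  case (Suc L)
  then obtain P S D A B where "height_profile (real L / 16) (real L * \<eta>) P S D A B" by blast
  from height_profile_step[OF this assms] obtain P' S' D' A' B'
    where "height_profile (real L / 16 + 1 / 16) (real L * \<eta> + \<eta>) P' S' D' A' B'" by blast
  moreover have "real L / 16 + 1 / 16 = real (Suc L) / 16" "real L * \<eta> + \<eta> = real (Suc L) * \<eta>"
    by (simp_all add: algebra_simps add_divide_distrib)
  ultimately show ?case by metis
qed

text \<open>
  Every level adds \<open>1 / 16\<close>, so finitely many levels suffice, and the admissible exceptional density is shared out
  among them.
\<close>

lemma unbounded_pair_density: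
  fixes c \<eta> :: real
  assumes "0 < \<eta>"
  obtains P S D A B where "height_profile c \<eta> P S D A B"
proof -
  obtain L :: nat where L: "16 * max c 1 < real L" using reals_Archimedean2 by blast
  then have "L > 0" by (cases L) auto
  obtain P S D A B where *: "height_profile (real L / 16) (real L * (\<eta> / real L)) P S D A B"
    using height_profile_exists[of "\<eta> / real L" L] assms \<open>L > 0\<close> by auto
  have cL: "c \<le> real L / 16" using L by linarith
  have "height_profile c \<eta> P S D A B"
    unfolding height_profile_def
  proof (intro conjI allI)
    fix k
    have "card {n. n < k * P \<and> pair_density A B S n < c} \<le>
        card {n. n < k * P \<and> pair_density A B S n < real L / 16}"
      using cL by (intro card_mono) auto
    then have "real (card {n. n < k * P \<and> pair_density A B S n < c}) \<le>
        real (card {n. n < k * P \<and> pair_density A B S n < real L / 16})" by simp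
    also have "\<dots> \<le> real L * (\<eta> / real L) * real (k * P)"
      using * unfolding height_profile_def by blast
    finally show "real (card {n. n < k * P \<and> pair_density A B S n < c}) \<le> \<eta> * real (k * P)"
      using \<open>L > 0\<close> by simp
  qed (use * in \<open>auto simp: height_profile_def\<close>)
  then show thesis by (rule that)
qed

section \<open>Sparse pairs of sequences on a grid\<close>

text \<open>
  Discrete data for one summand of the final functions: two height sequences supported below \<open>H\<close>, of mean at most
  \<open>\<delta>\<close> relative to \<open>N\<close>, such that an eighth of the points below \<open>N\<close> sees a pair of bumps whose heights have
  a product of at least half the step \<open>s\<close>.
\<close>

definition sparse_pair :: "real \<Rightarrow> nat \<Rightarrow> nat \<Rightarrow> (nat \<Rightarrow> real) \<Rightarrow> (nat \<Rightarrow> real) \<Rightarrow> bool" where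
  "sparse_pair \<delta> N H a b \<longleftrightarrow>
     0 < N \<and> (\<forall>i. 0 \<le> a i \<and> 0 \<le> b i) \<and> (\<forall>i\<ge>H. a i = 0 \<and> b i = 0) \<and>
     (\<Sum>i<H. a i) \<le> \<delta> * real N \<and> (\<Sum>i<H. b i) \<le> \<delta> * real N \<and>
     real N / 8 \<le> real (card {n. n < N \<and> (\<exists>s\<ge>1. real s \<le> 2 * (a (n + s) * b (n + 2 * s)))})"

text \<open>
  Random thinning needs heights that are at least one, since \<open>\<epsilon> / a i\<close> is a probability. A profile only has
  positive heights, so each of its cells is subdivided into \<open>K = (2 * \<kappa>)\<^sup>2\<close> cells and all heights are multiplied by
  \<open>2 * \<kappa>\<close>. Both the steps and the products of heights then grow by the factor \<open>K\<close>, and the pair density only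
  loses a constant on half of the points: if \<open>n\<close> has offset \<open>r < K / 2\<close> in its cell and \<open>s\<close> has remainder \<open>\<rho> < K / 4\<close>, then
  neither \<open>r + \<rho>\<close> nor \<open>r + 2 * \<rho>\<close> carries into the next cell.
\<close>

lemma sparse_pair_exists:
  fixes \<delta> :: real
  assumes "0 < \<delta>"
  shows "\<exists>N H a b. sparse_pair \<delta> N H a b"
proof -
  \<comment> \<open>With this choice both the masses and the missed points stay below \<open>\<mu> / 8\<close> times \<open>N\<close>.\<close>
  define \<mu> where "\<mu> = min 1 \<delta>"
  have \<mu>: "0 < \<mu>" "\<mu> \<le> 1" "\<mu> \<le> \<delta>" using assms by (auto simp: \<mu>_def)
  define \<epsilon> where "\<epsilon> = \<mu> / 64"
  have \<epsilon>: "0 < \<epsilon>" "\<epsilon> \<le> 1" using \<mu> by (auto simp: \<epsilon>_def)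
  define \<Lambda> where "\<Lambda> = ln (16 / \<mu>)"
  have exp\<Lambda>: "exp (- \<Lambda>) = \<mu> / 16" using \<mu> by (simp add: \<Lambda>_def exp_minus)
  obtain P S D A B where prof: "height_profile (4 * \<Lambda> / \<epsilon>\<^sup>2) (1 / 2) P S D A B"
    by (rule unbounded_pair_density[of "1 / 2"]) simp
  define c where "c = 4 * \<Lambda> / \<epsilon>\<^sup>2"
  have P: "0 < P" and D: "1 \<le> D"
    and A: "\<And>n. 1 / D \<le> A n" and B: "\<And>n. 1 / D \<le> B n"
    and bad: "\<And>k. real (card {n. n < k * P \<and> pair_density A B S n < c}) \<le> 1 / 2 * real (k * P)"
    using prof unfolding height_profile_def c_def by blast+
  \<comment> \<open>All heights of the profile are at least \<open>1 / D\<close>, so \<open>\<kappa> \<ge> D\<close> lifts them above one.\<close>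
  obtain \<kappa> :: nat where \<kappa>: "D \<le> real \<kappa>" using real_arch_simple by blast
  have \<kappa>1: "1 \<le> \<kappa>" using D \<kappa> by linarith
  define K where "K = 4 * \<kappa>\<^sup>2"
  have K: "0 < K" using \<kappa>1 by (simp add: K_def)
  define a0 where "a0 i = 2 * real \<kappa> * A (i div K)" for i
  define b0 where "b0 i = 2 * real \<kappa> * B (i div K)" for i
  have big: "1 \<le> 2 * real \<kappa> * t" if "1 / D \<le> t" for t
  proof -
    have "1 \<le> 2 * real \<kappa> * (1 / D)" using D \<kappa> by (simp add: field_simps)
    also have "\<dots> \<le> 2 * real \<kappa> * t" using that by (intro mult_left_mono) auto
    finally show ?thesis .
  qed
  have a0: "1 \<le> a0 i" and b0: "1 \<le> b0 i" for i
    unfolding a0_def b0_def by (intro big A B)+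
  have a0b0: "a0 i * b0 j = real K * (A (i div K) * B (j div K))" for i j
    by (simp add: a0_def b0_def K_def power2_eq_square)
  \<comment> \<open>With this many periods the extra room of length \<open>K * Z\<close> that the steps need is at most \<open>N\<close>.\<close>
  define Z where "Z = 2 * (S + 1)"
  define N where "N = K * (Z * P)"
  define H where "H = N + K * Z"
  have N: "0 < N" using K P by (simp add: N_def Z_def)
  have HN: "H \<le> 2 * N"
  proof -
    have "K * Z * 1 \<le> K * Z * P" using P by (intro mult_le_mono) auto
    then show ?thesis by (simp add: H_def N_def mult.assoc)
  qed
  define Good where "Good = {n. n < Z * P \<and> c \<le> pair_density A B S n}"
  define X where "X = (\<lambda>(n, r). K * n + r) ` (Good \<times> {..<2 * \<kappa>\<^sup>2})"
  have finX: "finite X" by (auto simp: X_def Good_def)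
  have block: "(K * n + r) div K = n" "(K * n + r) mod K = r" if "r < K" for n r
    using that by simp_all
  have cardX: "card X = card Good * (2 * \<kappa>\<^sup>2)"
  proof -
    have "inj_on (\<lambda>(n, r). K * n + r) (Good \<times> {..<2 * \<kappa>\<^sup>2})"
    proof (rule inj_onI, clarsimp)
      fix n r n' r' assume r: "r < 2 * \<kappa>\<^sup>2" "r' < 2 * \<kappa>\<^sup>2" and eq: "K * n + r = K * n' + r'"
      have "r < K" "r' < K" using r by (auto simp: K_def)
      then show "n = n' \<and> r = r'" using eq block by metis
    qed
    then show ?thesis by (simp add: X_def card_image card_cartesian_product)
  qed
  have Good: "real (Z * P) / 2 \<le> real (card Good)"
  proof -
    have "{..<Z * P} = Good \<union> {n. n < Z * P \<and> pair_density A B S n < c}"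
      by (auto simp: Good_def)
    then have "Z * P = card (Good \<union> {n. n < Z * P \<and> pair_density A B S n < c})"
      by (metis card_lessThan)
    also have "\<dots> \<le> card Good + card {n. n < Z * P \<and> pair_density A B S n < c}"
      by (rule card_Un_le)
    finally have "real (Z * P) \<le> real (card Good) + real (card {n. n < Z * P \<and> pair_density A B S n < c})"
      by linarith
    then show ?thesis using bad[of Z] by linarith
  qed
  have "real N / 4 = real (Z * P) / 2 * (2 * real \<kappa> ^ 2)" by (simp add: N_def K_def)
  also have "\<dots> \<le> real (card X)"
    unfolding cardX of_nat_mult using Good by (intro mult_mono) auto
  finally have X_ge: "real N / 4 \<le> real (card X)" .
  have XN: "X \<subseteq> {..<N}"
  proof (clarsimp simp: X_def)
    fix n r assume n: "n \<in> Good" and r: "r < 2 * \<kappa>\<^sup>2"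
    have "K * n + r < K * (n + 1)" using r by (simp add: K_def)
    also have "\<dots> \<le> N" unfolding N_def using n by (intro mult_le_mono) (auto simp: Good_def)
    finally show "K * n + r < N" .
  qed
  have X_le: "card X \<le> N" using card_mono[OF _ XN] by simp
  define U where "U n = {s\<in>{1..S}. real s \<le> A (n + s) * B (n + 2 * s)}" for n
  define W where "W n' = (\<lambda>(s, \<rho>). K * s + \<rho>) ` (U (n' div K) \<times> {..<\<kappa>\<^sup>2})" for n'
  have key: "(n' + s') div K = n' div K + s \<and> (n' + 2 * s') div K = n' div K + 2 * s"
    if n'X: "n' \<in> X" and s': "s' = K * s + \<rho>" and \<rho>: "\<rho> < \<kappa>\<^sup>2" for n' s' s \<rho>
  proof -
    obtain n r where n': "n' = K * n + r" "r < 2 * \<kappa>\<^sup>2" using n'X by (auto simp: X_def)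
    have r: "r < K" "r + \<rho> < K" "r + 2 * \<rho> < K" using n'(2) \<rho> by (auto simp: K_def)
    have "n' + s' = K * (n + s) + (r + \<rho>)" "n' + 2 * s' = K * (n + 2 * s) + (r + 2 * \<rho>)"
      unfolding n'(1) s' by (simp_all add: algebra_simps)
    then show ?thesis using block(1) r n'(1) by metis
  qed
  obtain F G where FG: "F \<subseteq> {..<H}" "G \<subseteq> {..<H}" and
    tot: "(\<Sum>i\<in>F. a0 i) + (\<Sum>i\<in>G. b0 i) +
       card {n\<in>X. \<forall>s\<in>W n. \<not> (n + s \<in> F \<and> n + 2 * s \<in> G)} \<le> 2 * \<epsilon> * H + card X * exp (- \<Lambda>)"
  proof (rule random_thinning[of \<epsilon> a0 b0 X W H \<Lambda>])
    show "0 \<le> \<epsilon>" "\<epsilon> \<le> 1" "finite X" using \<epsilon> finX by auto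
    show "1 \<le> a0 i" "1 \<le> b0 i" for i by (fact a0 b0)+
    fix n' assume n': "n' \<in> X"
    show "finite (W n')" by (auto simp: W_def U_def)
    show "n' + 2 * s' < H" if s': "s' \<in> W n'" for s'
    proof -
      obtain s \<rho> where s: "s' = K * s + \<rho>" "s \<le> S" "\<rho> < \<kappa>\<^sup>2" using s' by (auto simp: W_def U_def)
      have "\<rho> < K" using s(3) by (simp add: K_def)
      then have "s' < K * (s + 1)" using s(1) by simp
      also have "\<dots> \<le> K * (S + 1)" using s(2) by (intro mult_le_mono) auto
      finally have "2 * s' < K * Z" by (simp add: Z_def)
      then show ?thesis using XN n' by (auto simp: H_def)
    qed
    have inj: "inj_on (\<lambda>(s, \<rho>). K * s + \<rho>) (U (n' div K) \<times> {..<\<kappa>\<^sup>2})"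
    proof (rule inj_onI, clarsimp)
      fix n r n2 r2 assume r: "r < \<kappa>\<^sup>2" "r2 < \<kappa>\<^sup>2" and eq: "K * n + r = K * n2 + r2"
      have "r < K" "r2 < K" using r by (auto simp: K_def)
      then show "n = n2 \<and> r = r2" using eq block by metis
    qed
    have "c \<le> pair_density A B S (n' div K)"
    proof -
      obtain n r where n: "n' = K * n + r" "r < 2 * \<kappa>\<^sup>2" "n \<in> Good" using n' by (auto simp: X_def)
      have "n' div K = n" using block(1) n by (simp add: K_def)
      then show ?thesis using n(3) by (simp add: Good_def)
    qed
    then have "\<Lambda> \<le> \<epsilon>\<^sup>2 / 4 * pair_density A B S (n' div K)"
      using \<epsilon> by (simp add: c_def field_simps)
    also have "\<dots> = (\<Sum>s\<in>U (n' div K). \<Sum>\<rho><\<kappa>\<^sup>2.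
        \<epsilon>\<^sup>2 / (real K * (A (n' div K + s) * B (n' div K + 2 * s))))"
      unfolding pair_density_def U_def sum_distrib_left using \<kappa>1
      by (intro sum.cong refl) (simp add: K_def field_simps)
    also have "\<dots> = (\<Sum>s\<in>U (n' div K). \<Sum>\<rho><\<kappa>\<^sup>2.
        \<epsilon>\<^sup>2 / (a0 (n' + (K * s + \<rho>)) * b0 (n' + 2 * (K * s + \<rho>))))"
    proof (intro sum.cong refl)
      fix s \<rho> assume "\<rho> \<in> {..<\<kappa>\<^sup>2}"
      then show "\<epsilon>\<^sup>2 / (real K * (A (n' div K + s) * B (n' div K + 2 * s))) =
         \<epsilon>\<^sup>2 / (a0 (n' + (K * s + \<rho>)) * b0 (n' + 2 * (K * s + \<rho>)))"
        unfolding a0b0 using key[OF n' refl, of \<rho> s] by simp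
    qed
    also have "\<dots> = (\<Sum>(s, \<rho>)\<in>U (n' div K) \<times> {..<\<kappa>\<^sup>2}.
        \<epsilon>\<^sup>2 / (a0 (n' + (K * s + \<rho>)) * b0 (n' + 2 * (K * s + \<rho>))))"
      by (rule sum.cartesian_product)
    also have "\<dots> = (\<Sum>s\<in>W n'. \<epsilon>\<^sup>2 / (a0 (n' + s) * b0 (n' + 2 * s)))"
      unfolding W_def by (subst sum.reindex[OF inj]) (simp add: case_prod_unfold)
    finally show "\<Lambda> \<le> (\<Sum>s\<in>W n'. \<epsilon>\<^sup>2 / (a0 (n' + s) * b0 (n' + 2 * s)))" .
  qed
  let ?unc = "{n\<in>X. \<forall>s\<in>W n. \<not> (n + s \<in> F \<and> n + 2 * s \<in> G)}"
  have "2 * \<epsilon> * real H + real (card X) * exp (- \<Lambda>) \<le> 2 * \<epsilon> * (2 * real N) + real N * (\<mu> / 16)"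
    unfolding exp\<Lambda> using HN X_le \<epsilon> \<mu> by (intro add_mono mult_mono mult_left_mono) auto
  also have "\<dots> = \<mu> / 8 * real N" by (simp add: \<epsilon>_def)
  finally have tot': "(\<Sum>i\<in>F. a0 i) + (\<Sum>i\<in>G. b0 i) + card ?unc \<le> \<mu> / 8 * real N"
    using tot by linarith
  have nn: "0 \<le> (\<Sum>i\<in>F. a0 i)" "0 \<le> (\<Sum>i\<in>G. b0 i)"
    using a0 b0 by (intro sum_nonneg; smt (verit))+
  have \<mu>N: "\<mu> / 8 * real N \<le> \<delta> * real N" "\<mu> / 8 * real N \<le> real N / 8"
    using \<mu> N by (auto intro: mult_right_mono)
  define a where "a i = (if i \<in> F then a0 i else 0)" for i
  define b where "b i = (if i \<in> G then b0 i else 0)" for i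
  have sums: "(\<Sum>i<H. a i) = (\<Sum>i\<in>F. a0 i)" "(\<Sum>i<H. b i) = (\<Sum>i\<in>G. b0 i)"
    using FG unfolding a_def b_def by (simp_all add: sum.If_cases Int_absorb1)
  let ?E = "{n. n < N \<and> (\<exists>s\<ge>1. real s \<le> 2 * (a (n + s) * b (n + 2 * s)))}"
  have covered: "X - ?unc \<subseteq> ?E"
  proof
    fix n' assume n': "n' \<in> X - ?unc"
    then obtain s' where s': "s' \<in> W n'" "n' + s' \<in> F" "n' + 2 * s' \<in> G" by auto
    obtain s \<rho> where s: "s' = K * s + \<rho>" "s \<in> U (n' div K)" "\<rho> < \<kappa>\<^sup>2"
      using s'(1) by (auto simp: W_def)
    have s1: "1 \<le> s" and le: "real s \<le> A (n' div K + s) * B (n' div K + 2 * s)"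
      using s(2) by (auto simp: U_def)
    have "\<rho> < K" using s(3) by (simp add: K_def)
    moreover have "K * 1 \<le> K * s" using s1 by (intro mult_le_mono) auto
    ultimately have s2: "1 \<le> s'" "s' \<le> 2 * (K * s)" using s(1) K by linarith+
    have "real s' \<le> 2 * (real K * real s)" using of_nat_mono[OF s2(2), where 'a = real] by simp
    also have "\<dots> \<le> 2 * (real K * (A (n' div K + s) * B (n' div K + 2 * s)))"
      using le by (intro mult_left_mono) auto
    also have "\<dots> = 2 * (a (n' + s') * b (n' + 2 * s'))"
      using s'(2,3) key[of n' s' s \<rho>] n' s by (simp add: a_def b_def a0b0)
    finally show "n' \<in> ?E" using s2(1) n' XN by auto
  qed
  have "real (card X) - real (card ?unc) \<le> real (card (X - ?unc))"
    using finX diff_card_le_card_Diff[of ?unc X] by simp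
  also have "\<dots> \<le> real (card ?E)"
    using covered by (simp add: card_mono)
  finally have E: "real N / 8 \<le> real (card ?E)"
    using X_ge tot' nn \<mu>N(2) by linarith
  have "sparse_pair \<delta> N H a b"
    unfolding sparse_pair_def
  proof (intro conjI allI impI)
    show "0 \<le> a i" "0 \<le> b i" for i using a0[of i] b0[of i] by (auto simp: a_def b_def)
    show "a i = 0" "b i = 0" if "H \<le> i" for i using that FG by (auto simp: a_def b_def)
    show "(\<Sum>i<H. a i) \<le> \<delta> * real N" "(\<Sum>i<H. b i) \<le> \<delta> * real N"
      unfolding sums using tot' nn \<mu>N(1) by linarith+
  qed (use N E in auto)
  then show ?thesis by blast
qed

section \<open>From the grid to the real line\<close>

definition grid_function :: "nat \<Rightarrow> (nat \<Rightarrow> real) \<Rightarrow> real \<Rightarrow> real" where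
  "grid_function N a x = (if 0 \<le> x then a (nat \<lfloor>real N * x\<rfloor>) else 0)"

lemma grid_function_measurable [measurable]: "grid_function N a \<in> borel_measurable borel"
  unfolding grid_function_def by measurable

lemma grid_function_nonneg: "(\<And>i. 0 \<le> a i) \<Longrightarrow> 0 \<le> grid_function N a x"
  by (simp add: grid_function_def)

lemma grid_function_eq:
  assumes "real i \<le> real N * x" "real N * x < real i + 1" "0 < N"
  shows "grid_function N a x = a i"
proof -
  have "\<lfloor>real N * x\<rfloor> = int i" using assms by (intro floor_unique) auto
  moreover have "0 \<le> x" using assms by (smt (verit) of_nat_0_le_iff of_nat_0_less_iff zero_le_mult_iff)
  ultimately show ?thesis by (simp add: grid_function_def)
qed

lemma nn_integral_grid_function:
  assumes "0 < N" "\<And>i. 0 \<le> a i" "\<And>i. H \<le> i \<Longrightarrow> a i = 0"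
  shows "(\<integral>\<^sup>+x. ennreal (grid_function N a x) \<partial>lborel) = ennreal ((\<Sum>i<H. a i) / real N)"
proof -
  let ?I = "\<lambda>i. {real i / real N..<(real i + 1) / real N}"
  have eq: "ennreal (grid_function N a x) = (\<Sum>i<H. ennreal (a i) * indicator (?I i) x)" for x
  proof (cases "0 \<le> x")
    case True
    define k where "k = nat \<lfloor>real N * x\<rfloor>"
    have mem: "x \<in> ?I i \<longleftrightarrow> i = k" for i
    proof -
      have "x \<in> ?I i \<longleftrightarrow> real i \<le> real N * x \<and> real N * x < real i + 1"
        using assms(1) by (auto simp: field_simps)
      also have "\<dots> \<longleftrightarrow> \<lfloor>real N * x\<rfloor> = int i" by (auto simp: floor_eq_iff)
      also have "\<dots> \<longleftrightarrow> i = k" using True unfolding k_def by auto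
      finally show ?thesis .
    qed
    have "(\<Sum>i<H. ennreal (a i) * indicator (?I i) x) = (\<Sum>i<H. if i = k then ennreal (a k) else 0)"
      by (intro sum.cong) (auto simp: indicator_def mem simp del: atLeastLessThan_iff)
    also have "\<dots> = ennreal (a k)" using assms(3)[of k] by (auto simp: not_less)
    finally show ?thesis using True by (simp add: grid_function_def k_def)
  next
    case False
    then have "x \<notin> ?I i" for i using assms(1) by (auto simp: field_simps) (smt (verit) of_nat_0_le_iff of_nat_0_less_iff mult_less_0_iff mult.commute)
    then have "(\<Sum>i<H. ennreal (a i) * indicator (?I i) x) = 0"
      by (intro sum.neutral) (simp add: indicator_def del: atLeastLessThan_iff)
    then show ?thesis using False by (simp add: grid_function_def)
  qed
  have len: "emeasure lborel (?I i) = ennreal (1 / real N)" for i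
    using assms(1) by (simp add: divide_right_mono diff_divide_distrib[symmetric])
  have "(\<integral>\<^sup>+x. ennreal (grid_function N a x) \<partial>lborel) = (\<Sum>i<H. ennreal (a i) * ennreal (1 / real N))"
    unfolding eq by (subst nn_integral_sum) (auto simp: nn_integral_cmult_indicator len simp del: emeasure_lborel_Ico)
  also have "\<dots> = ennreal ((\<Sum>i<H. a i) / real N)"
    using assms by (simp add: ennreal_mult[symmetric] sum_divide_distrib del: ennreal_mult)
  finally show ?thesis .
qed

text \<open>
  Integrate over \<open>x\<close> first. For fixed \<open>s\<close> a translation in \<open>x\<close> turns the integrand into
  \<open>f x * g (x + s)\<close>, and the double integral becomes the product of the two norms.
\<close>

lemma bilinear_product_integrable:
  fixes f g :: "real \<Rightarrow> real"
  assumes [measurable]: "f \<in> borel_measurable borel" "g \<in> borel_measurable borel"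
    and nonneg: "\<And>x. 0 \<le> f x" "\<And>x. 0 \<le> g x"
    and fin: "integrable lborel f" "integrable lborel g"
  shows "AE x in lborel. integrable lborel (\<lambda>s. f (x + s) * g (x + 2 * s))"
proof -
  let ?F = "\<lambda>x. ennreal (f x)" and ?G = "\<lambda>x. ennreal (g x)"
  have "(\<integral>\<^sup>+x. \<integral>\<^sup>+s. ?F (x + s) * ?G (x + 2 * s) \<partial>lborel \<partial>lborel) =
      (\<integral>\<^sup>+s. \<integral>\<^sup>+x. ?F (x + s) * ?G (x + 2 * s) \<partial>lborel \<partial>lborel)"
    by (rule lborel_pair.Fubini'[symmetric]) measurable
  also have "\<dots> = (\<integral>\<^sup>+s. \<integral>\<^sup>+x. ?F x * ?G (x + s) \<partial>lborel \<partial>lborel)"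
  proof (rule nn_integral_cong)
    fix s :: real
    have "(\<integral>\<^sup>+x. ?F x * ?G (x + s) \<partial>lborel) = ennreal \<bar>1\<bar> * (\<integral>\<^sup>+x. ?F (s + 1 * x) * ?G (s + 1 * x + s) \<partial>lborel)"
      by (rule nn_integral_real_affine) auto
    then show "(\<integral>\<^sup>+x. ?F (x + s) * ?G (x + 2 * s) \<partial>lborel) = (\<integral>\<^sup>+x. ?F x * ?G (x + s) \<partial>lborel)"
      by (simp add: algebra_simps)
  qed
  also have "\<dots> = (\<integral>\<^sup>+x. \<integral>\<^sup>+s. ?F x * ?G (x + s) \<partial>lborel \<partial>lborel)"
    by (rule lborel_pair.Fubini') measurable
  also have "\<dots> = (\<integral>\<^sup>+x. ?F x * (\<integral>\<^sup>+s. ?G s \<partial>lborel) \<partial>lborel)"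
  proof (rule nn_integral_cong)
    fix x :: real
    have "(\<integral>\<^sup>+s. ?G s \<partial>lborel) = ennreal \<bar>1\<bar> * (\<integral>\<^sup>+s. ?G (x + 1 * s) \<partial>lborel)"
      by (rule nn_integral_real_affine) auto
    then show "(\<integral>\<^sup>+s. ?F x * ?G (x + s) \<partial>lborel) = ?F x * (\<integral>\<^sup>+s. ?G s \<partial>lborel)"
      by (simp add: nn_integral_cmult)
  qed
  also have "\<dots> = (\<integral>\<^sup>+x. ?F x \<partial>lborel) * (\<integral>\<^sup>+s. ?G s \<partial>lborel)"
    by (rule nn_integral_multc) measurable
  also have "\<dots> < \<infinity>"
    using fin nonneg by (simp add: integrable_iff_bounded ennreal_mult_less_top)
  finally have "(\<integral>\<^sup>+x. \<integral>\<^sup>+s. ?F (x + s) * ?G (x + 2 * s) \<partial>lborel \<partial>lborel) \<noteq> \<infinity>" by simp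
  then have "AE x in lborel. (\<integral>\<^sup>+s. ?F (x + s) * ?G (x + 2 * s) \<partial>lborel) \<noteq> \<infinity>"
    by (intro nn_integral_PInf_AE) measurable
  then show ?thesis
  proof eventually_elim
    case (elim x)
    then show ?case using nonneg
      by (intro integrableI_bounded) (auto simp: ennreal_mult less_top)
  qed
qed

text \<open>
  A single pair of bumps suffices. Write \<open>N * x = n + \<xi>\<close> and \<open>N * \<sigma> = s + \<eta>\<close>. Then \<open>x + \<sigma>\<close> lies in
  cell \<open>n + s\<close> and \<open>x + 2 * \<sigma>\<close> in cell \<open>n + 2 * s\<close> as soon as \<open>- \<xi> / 2 \<le> \<eta> < (1 - \<xi>) / 2\<close>; this
  interval has length \<open>1 / 2\<close> for every \<open>\<xi>\<close>, so no point of the cell \<open>n\<close> is lost.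
\<close>

lemma bilinear_maximal_ge_on_grid:
  fixes f g :: "real \<Rightarrow> real"
  assumes N: "0 < N" and ab: "\<And>i. 0 \<le> a i" "\<And>i. 0 \<le> b i" and c: "0 \<le> c"
    and nonneg: "\<And>x. 0 \<le> f x" "\<And>x. 0 \<le> g x"
    and int: "integrable lborel (\<lambda>\<sigma>. f (x + \<sigma>) * g (x + 2 * \<sigma>))"
    and f: "AE \<sigma> in lborel. c * grid_function N a (x + \<sigma>) \<le> f (x + \<sigma>)"
    and g: "AE \<sigma> in lborel. c * grid_function N b (x + 2 * \<sigma>) \<le> g (x + 2 * \<sigma>)"
    and x: "real n \<le> real N * x" "real N * x < real n + 1"
    and s: "1 \<le> s" "real s \<le> 2 * (a (n + s) * b (n + 2 * s))"
  shows "ereal (c\<^sup>2 / 16) \<le> bilinear_maximal f g x"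
proof -
  define \<xi> where "\<xi> = real N * x - real n"
  have \<xi>: "0 \<le> \<xi>" "\<xi> < 1" and Nx: "real N * x = real n + \<xi>" using x by (auto simp: \<xi>_def)
  define t where "t = 2 * real s / real N"
  have Npos: "real N > 0" using N by simp
  have tpos: "t > 0" using s Npos by (simp add: t_def)
  \<comment> \<open>The interval of those \<open>\<sigma>\<close> for which both points lie in the prescribed cells.\<close>
  define l where "l = (real s - \<xi> / 2) / real N"
  define r where "r = (real s + (1 - \<xi>) / 2) / real N"
  have lr: "l \<le> r" "r - l = 1 / (2 * real N)"
    unfolding l_def r_def by (auto intro!: divide_right_mono simp: diff_divide_distrib[symmetric] field_simps)
  define v where "v = c\<^sup>2 * (a (n + s) * b (n + 2 * s))"
  have vpos: "0 \<le> v" using ab by (simp add: v_def)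
  have sub: "{l..<r} \<subseteq> {-t..t}"
  proof -
    have "0 \<le> l" "r \<le> t" unfolding l_def r_def t_def using s(1) \<xi> Npos
      by (auto intro!: divide_right_mono)
    then show ?thesis using tpos by auto
  qed
  have lower: "AE \<sigma> in lborel. indicator {l..<r} \<sigma> * v \<le> indicator {-t..t} \<sigma> * (f (x + \<sigma>) * g (x + 2 * \<sigma>))"
    using f g
  proof eventually_elim
    case (elim \<sigma>)
    show ?case
    proof (cases "\<sigma> \<in> {l..<r}")
      case True
      then have N\<sigma>: "real s - \<xi> / 2 \<le> real N * \<sigma>" "2 * (real N * \<sigma>) < 2 * real s + 1 - \<xi>"
        using Npos by (auto simp: l_def r_def field_simps)
      have "real s \<le> \<xi> + real N * \<sigma>" "\<xi> + real N * \<sigma> < real s + 1"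
        using N\<sigma> \<xi> by linarith+
      then have "grid_function N a (x + \<sigma>) = a (n + s)"
        by (intro grid_function_eq N) (simp_all add: Nx distrib_left)
      moreover have "real (n + 2 * s) \<le> real N * (x + 2 * \<sigma>)" "real N * (x + 2 * \<sigma>) < real (n + 2 * s) + 1"
      proof -
        have "real N * (x + 2 * \<sigma>) = real n + \<xi> + 2 * (real N * \<sigma>)"
          by (simp add: Nx distrib_left)
        then show "real (n + 2 * s) \<le> real N * (x + 2 * \<sigma>)" "real N * (x + 2 * \<sigma>) < real (n + 2 * s) + 1"
          using N\<sigma> by simp_all
      qed
      then have "grid_function N b (x + 2 * \<sigma>) = b (n + 2 * s)"
        by (intro grid_function_eq N)
      ultimately have "(c * a (n + s)) * (c * b (n + 2 * s)) \<le> f (x + \<sigma>) * g (x + 2 * \<sigma>)"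
        using elim ab c nonneg by (intro mult_mono) auto
      moreover have "\<sigma> \<in> {-t..t}" using True sub by blast
      ultimately show ?thesis
        using True by (simp add: v_def power2_eq_square mult_ac del: atLeastAtMost_iff atLeastLessThan_iff)
    next
      case False
      then show ?thesis using nonneg by (simp add: indicator_def del: atLeastAtMost_iff atLeastLessThan_iff)
    qed
  qed
  have "v * (1 / (2 * real N)) = (LINT \<sigma>|lborel. indicator {l..<r} \<sigma> * v)"
    using lr by simp
  also have "\<dots> \<le> (LINT \<sigma>|lborel. indicator {-t..t} \<sigma> * (f (x + \<sigma>) * g (x + 2 * \<sigma>)))"
  proof (rule integral_mono_AE[OF _ _ lower])
    show "integrable lborel (\<lambda>\<sigma>. indicator {l..<r} \<sigma> * v)"
      using lr by (auto intro!: integrable_mult_left integrable_real_indicator)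
    show "integrable lborel (\<lambda>\<sigma>. indicator {-t..t} \<sigma> * (f (x + \<sigma>) * g (x + 2 * \<sigma>)))"
      using integrable_mult_indicator[OF _ int, of "{-t..t}"] by simp
  qed
  also have "\<dots> = (LINT \<sigma>:{-t..t}|lebesgue. f (x + \<sigma>) * g (x + 2 * \<sigma>))"
    unfolding set_lebesgue_integral_def using integrable_mult_indicator[OF _ int, of "{-t..t}"]
    by (subst integral_completion) auto
  finally have "1 / (2 * t) * (v * (1 / (2 * real N))) \<le>
      1 / (2 * t) * (LINT \<sigma>:{-t..t}|lebesgue. f (x + \<sigma>) * g (x + 2 * \<sigma>))"
    using tpos by (intro mult_left_mono) auto
  moreover have "c\<^sup>2 / 16 \<le> 1 / (2 * t) * (v * (1 / (2 * real N)))"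
  proof -
    have "c\<^sup>2 / 16 = c\<^sup>2 * real s / (16 * real s)" using s(1) by simp
    also have "\<dots> \<le> c\<^sup>2 * (2 * (a (n + s) * b (n + 2 * s))) / (16 * real s)"
      using s(2) by (intro divide_right_mono mult_left_mono) auto
    also have "\<dots> = 1 / (2 * t) * (v * (1 / (2 * real N)))"
      using s(1) Npos by (simp add: t_def v_def field_simps)
    finally show ?thesis .
  qed
  ultimately have "c\<^sup>2 / 16 \<le> 1 / (2 * t) * (LINT \<sigma>:{-t..t}|lebesgue. f (x + \<sigma>) * g (x + 2 * \<sigma>))"
    by linarith
  then show ?thesis
    unfolding bilinear_maximal_def using tpos by (intro SUP_upper2[of t]) auto
qed

text \<open>
  Continuity from above along the decreasing unions of the tails of the sequence.
\<close>

lemma limsup_sets_not_null: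
  fixes E :: "nat \<Rightarrow> 'a set"
  assumes [measurable]: "\<And>m. E m \<in> sets M"
    and B: "B \<in> sets M" "emeasure M B < \<infinity>" "\<And>m. E m \<subseteq> B"
    and large: "0 < \<alpha>" "\<And>m. \<alpha> \<le> emeasure M (E m)"
  shows "\<not> (AE x in M. \<exists>k. \<forall>m\<ge>k. x \<notin> E m)"
proof
  assume ae: "AE x in M. \<exists>k. \<forall>m\<ge>k. x \<notin> E m"
  define V where "V k = (\<Union>m\<in>{k..}. E m)" for k
  have V [measurable]: "V k \<in> sets M" for k unfolding V_def by measurable
  have "V k \<subseteq> B" for k using B(3) by (auto simp: V_def)
  then have "emeasure M (V k) \<noteq> \<infinity>" for k
    using emeasure_mono[OF _ B(1), of "V k"] B(2) by (simp add: less_top order_le_less_trans)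
  then have "(INF k. emeasure M (V k)) = emeasure M (\<Inter>k. V k)"
    by (intro INF_emeasure_decseq) (auto simp: decseq_def V_def intro: order_trans)
  moreover have "\<alpha> \<le> (INF k. emeasure M (V k))"
  proof (rule INF_greatest)
    fix k
    have "\<alpha> \<le> emeasure M (E k)" by (rule large)
    also have "\<dots> \<le> emeasure M (V k)" by (intro emeasure_mono V) (auto simp: V_def)
    finally show "\<alpha> \<le> emeasure M (V k)" .
  qed
  moreover have "emeasure M (\<Inter>k. V k) = 0"
  proof -
    have "AE x in M. x \<notin> (\<Inter>k. V k)" using ae by eventually_elim (auto simp: V_def)
    then show ?thesis by (subst (asm) AE_iff_null_sets[symmetric]) (auto intro: null_setsD1)
  qed
  ultimately show False using large(1) by simp
qed

text \<open>
  The function is the sum of all \<open>h m\<close>. It may be infinite on a null set, which is why the domination is only claimed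
  almost everywhere.
\<close>

lemma integrable_dominating_sum:
  fixes h :: "nat \<Rightarrow> real \<Rightarrow> real"
  assumes [measurable]: "\<And>m. h m \<in> borel_measurable borel"
    and nonneg: "\<And>m x. 0 \<le> h m x"
    and small: "\<And>m. (\<integral>\<^sup>+x. ennreal (h m x) \<partial>lborel) \<le> ennreal ((1 / 2) ^ m)"
  obtains f :: "real \<Rightarrow> real" where "f \<in> borel_measurable borel" "\<And>x. 0 \<le> f x"
    "integrable lborel f" "AE x in lborel. \<forall>m. h m x \<le> f x"
proof -
  define F where "F x = (\<Sum>m. ennreal (h m x))" for x
  have F [measurable]: "F \<in> borel_measurable borel" unfolding F_def by measurable
  have "(\<integral>\<^sup>+x. F x \<partial>lborel) = (\<Sum>m. \<integral>\<^sup>+x. ennreal (h m x) \<partial>lborel)"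
    unfolding F_def by (rule nn_integral_suminf) measurable
  also have "\<dots> \<le> (\<Sum>m. ennreal ((1 / 2) ^ m))" by (intro suminf_le small) auto
  also have "\<dots> = ennreal (\<Sum>m. (1 / 2) ^ m)"
    by (rule suminf_ennreal2) (auto intro: summable_geometric)
  finally have fin: "(\<integral>\<^sup>+x. F x \<partial>lborel) < \<infinity>" using le_less_trans by fastforce
  define f where "f x = enn2real (F x)" for x
  have f [measurable]: "f \<in> borel_measurable borel" unfolding f_def by measurable
  have f_le: "ennreal (f x) \<le> F x" for x
    unfolding f_def by (cases "F x") (auto simp: ennreal_enn2real_if)
  show thesis
  proof (rule that[of f])
    show "0 \<le> f x" for x by (simp add: f_def)
    have "(\<integral>\<^sup>+x. ennreal (f x) \<partial>lborel) \<le> (\<integral>\<^sup>+x. F x \<partial>lborel)" by (intro nn_integral_mono f_le)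
    then show "integrable lborel f"
      using fin by (intro integrableI_bounded) (auto simp: f_def)
    have "AE x in lborel. F x \<noteq> \<infinity>" using fin by (intro nn_integral_PInf_AE) auto
    then show "AE x in lborel. \<forall>m. h m x \<le> f x"
    proof eventually_elim
      case (elim x)
      have "ennreal (h m x) \<le> ennreal (f x)" for m
      proof -
        have "ennreal (h m x) \<le> F x"
          unfolding F_def using sum_le_suminf[of "\<lambda>m. ennreal (h m x)" "{m}"] by simp
        also have "\<dots> = ennreal (f x)" using elim by (simp add: f_def less_top)
        finally show ?thesis .
      qed
      then show ?case using nonneg by (auto simp: f_def ennreal_le_iff)
    qed
  qed (rule f)
qed

theorem theorem1:
  "\<exists>f g :: real \<Rightarrow> real. integrable lebesgue f \<and> integrable lebesgue g \<and>
     \<not> (AE x in lebesgue. bilinear_maximal f g x < \<infinity>)"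
proof -
  \<comment> \<open>The \<open>m\<close>-th pair is multiplied by \<open>m\<close>, so its mass must be summable even after this.\<close>
  define \<delta> :: "nat \<Rightarrow> real" where "\<delta> m = (1 / 2) ^ m / (real m + 1)" for m
  have "\<forall>m. \<exists>N H a b. sparse_pair (\<delta> m) N H a b"
    by (intro allI sparse_pair_exists) (simp add: \<delta>_def)
  then obtain N H a b where pair: "\<And>m. sparse_pair (\<delta> m) (N m) (H m) (a m) (b m)"
    by metis
  have N: "0 < N m" and a0: "0 \<le> a m i" and b0: "0 \<le> b m i"
    and aH: "H m \<le> i \<Longrightarrow> a m i = 0" and bH: "H m \<le> i \<Longrightarrow> b m i = 0"
    and asum: "(\<Sum>i<H m. a m i) \<le> \<delta> m * real (N m)"
    and bsum: "(\<Sum>i<H m. b m i) \<le> \<delta> m * real (N m)" for m i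
    using pair[of m] unfolding sparse_pair_def by blast+
  define good where "good m =
    {n. n < N m \<and> (\<exists>s\<ge>1. real s \<le> 2 * (a m (n + s) * b m (n + 2 * s)))}" for m
  have card_good: "real (N m) / 8 \<le> real (card (good m))" for m
    using pair[of m] unfolding sparse_pair_def good_def by blast
  have small: "(\<integral>\<^sup>+x. ennreal (real m * grid_function (N m) d x) \<partial>lborel) \<le> ennreal ((1 / 2) ^ m)"
    if d: "\<And>i. 0 \<le> d i" "\<And>i. H m \<le> i \<Longrightarrow> d i = 0" "(\<Sum>i<H m. d i) \<le> \<delta> m * real (N m)" for m d
  proof -
    have "(\<integral>\<^sup>+x. ennreal (real m * grid_function (N m) d x) \<partial>lborel) =
        ennreal (real m) * (\<integral>\<^sup>+x. ennreal (grid_function (N m) d x) \<partial>lborel)"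
      by (simp add: ennreal_mult' nn_integral_cmult)
    also have "\<dots> = ennreal (real m * ((\<Sum>i<H m. d i) / real (N m)))"
      using nn_integral_grid_function[of "N m" d "H m"] N d
      by (simp only: ennreal_mult'[OF of_nat_0_le_iff])
    also have "real m * ((\<Sum>i<H m. d i) / real (N m)) \<le> (real m + 1) * \<delta> m"
      using d N[of m] by (intro mult_mono) (auto simp: divide_le_eq sum_nonneg)
    also have "(real m + 1) * \<delta> m = (1 / 2) ^ m" by (simp add: \<delta>_def)
    finally show ?thesis by (simp add: ennreal_leI)
  qed
  obtain f where f [measurable]: "f \<in> borel_measurable borel" and f0: "\<And>x. 0 \<le> f x"
    and f_int: "integrable lborel f" and f_ge: "AE x in lborel. \<forall>m. real m * grid_function (N m) (a m) x \<le> f x"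
  proof (rule integrable_dominating_sum[of "\<lambda>m x. real m * grid_function (N m) (a m) x"])
  qed (use small a0 aH asum in \<open>auto simp: grid_function_nonneg\<close>)
  obtain g where g [measurable]: "g \<in> borel_measurable borel" and g0: "\<And>x. 0 \<le> g x"
    and g_int: "integrable lborel g" and g_ge: "AE x in lborel. \<forall>m. real m * grid_function (N m) (b m) x \<le> g x"
  proof (rule integrable_dominating_sum[of "\<lambda>m x. real m * grid_function (N m) (b m) x"])
  qed (use small b0 bH bsum in \<open>auto simp: grid_function_nonneg\<close>)
  define E where "E m = (\<Union>n\<in>good m. {real n / real (N m)..<(real n + 1) / real (N m)})" for m
  have large: "ennreal (1 / 8) \<le> emeasure lborel (E m)" for m
  proof -
    have fin: "finite (good m)" by (simp add: good_def)
    have len: "emeasure lborel {real n / real (N m)..<(real n + 1) / real (N m)} = ennreal (1 / real (N m))" for n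
      using N[of m] by (simp add: divide_right_mono diff_divide_distrib[symmetric])
    have disj: "disjoint_family_on (\<lambda>n. {real n / real (N m)..<(real n + 1) / real (N m)}) (good m)"
      using N[of m] by (auto simp: disjoint_family_on_def field_simps)
    have "emeasure lborel (E m) = (\<Sum>n\<in>(good m). ennreal (1 / real (N m)))"
      unfolding E_def by (subst sum_emeasure[symmetric, OF _ disj]) (auto simp: len fin simp del: emeasure_lborel_Ico)
    also have "\<dots> = ennreal (real (card (good m)) * (1 / real (N m)))"
      by (subst ennreal_mult'[OF of_nat_0_le_iff]) (simp add: ennreal_of_nat_eq_real_of_nat)
    finally show ?thesis using card_good[of m] N[of m] by (simp add: ennreal_leI field_simps)
  qed
  have bounded: "E m \<subseteq> {0..1}" for m
  proof
    fix x assume "x \<in> E m"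
    then obtain n where n: "n < N m" "real n / real (N m) \<le> x" "x < (real n + 1) / real (N m)"
      by (auto simp: E_def good_def)
    have "0 \<le> real n / real (N m)" by simp
    moreover have "(real n + 1) / real (N m) \<le> 1" using n(1) by (simp add: divide_le_eq)
    ultimately have "0 \<le> x" "x \<le> 1" using n by linarith+
    then show "x \<in> {0..1}" by simp
  qed
  have blowup: "ereal ((real m)\<^sup>2 / 16) \<le> bilinear_maximal f g x"
    if x: "x \<in> E m" and int: "integrable lborel (\<lambda>s. f (x + s) * g (x + 2 * s))" for m x
  proof -
    obtain n s where n: "real n / real (N m) \<le> x" "x < (real n + 1) / real (N m)"
      and s: "1 \<le> s" "real s \<le> 2 * (a m (n + s) * b m (n + 2 * s))"
      using x by (auto simp: E_def good_def)
    show ?thesis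
    proof (rule bilinear_maximal_ge_on_grid[where N = "N m" and a = "a m" and b = "b m"
          and f = f and g = g and x = x and n = n and s = s and c = "real m", OF N a0 b0 _ f0 g0 int _ _ _ _ s])
      show "AE \<sigma> in lborel. real m * grid_function (N m) (a m) (x + \<sigma>) \<le> f (x + \<sigma>)"
      proof -
        have "AE y in lborel. real m * grid_function (N m) (a m) y \<le> f y"
          using f_ge by eventually_elim blast
        then show ?thesis
          using AE_borel_affine[of 1 "\<lambda>y. real m * grid_function (N m) (a m) y \<le> f y" x] by simp
      qed
      show "AE \<sigma> in lborel. real m * grid_function (N m) (b m) (x + 2 * \<sigma>) \<le> g (x + 2 * \<sigma>)"
      proof -
        have "AE y in lborel. real m * grid_function (N m) (b m) y \<le> g y"
          using g_ge by eventually_elim blast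
        then show ?thesis
          using AE_borel_affine[of 2 "\<lambda>y. real m * grid_function (N m) (b m) y \<le> g y" x] by simp
      qed
      show "real n \<le> real (N m) * x" "real (N m) * x < real n + 1"
        using n N[of m] by (auto simp: field_simps)
    qed simp
  qed
  have "\<not> (AE x in lebesgue. bilinear_maximal f g x < \<infinity>)"
  proof
    assume "AE x in lebesgue. bilinear_maximal f g x < \<infinity>"
    then have "AE x in lborel. bilinear_maximal f g x < \<infinity>" by (simp add: AE_completion_iff)
    with bilinear_product_integrable[OF f g f0 g0 f_int g_int]
    have "AE x in lborel. \<exists>k. \<forall>m\<ge>k. x \<notin> E m"
    proof eventually_elim
      case (elim x)
      then obtain r where r: "bilinear_maximal f g x \<le> ereal r"
        by (cases "bilinear_maximal f g x") auto
      obtain k :: nat where k: "16 * (\<bar>r\<bar> + 1) < real k" using reals_Archimedean2 by blast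
      have "x \<notin> E m" if "k \<le> m" for m
      proof
        assume "x \<in> E m"
        then have "ereal ((real m)\<^sup>2 / 16) \<le> ereal r" using blowup elim(1) r by (meson order_trans)
        then have "(real m)\<^sup>2 \<le> 16 * r" by simp
        moreover have m: "16 * (\<bar>r\<bar> + 1) < real m" using k that by linarith
        then have "real m \<le> (real m)\<^sup>2" by (intro self_le_power) auto
        ultimately show False using m abs_ge_self[of r] by argo
      qed
      then show ?case by blast
    qed
    moreover have "\<not> (AE x in lborel. \<exists>k. \<forall>m\<ge>k. x \<notin> E m)"
      by (rule limsup_sets_not_null[where B = "{0..1}" and \<alpha> = "ennreal (1 / 8)"])
        (use bounded large in \<open>auto simp: E_def good_def\<close>)
    ultimately show False by contradiction
  qed
  moreover have "integrable lebesgue f" "integrable lebesgue g"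
    using f_int g_int by (auto simp: integrable_completion)
  ultimately show ?thesis by blast
qed

end
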